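(* Let $n,p$ be positive integers with $2p\le n$ and let $f:\mathbb{R}^{n\times p}\to\mathbb{R}$ be twice continuously differentiable. Let $X^0\in\mathbb{R}^{n\times p}$ be a qualified initial guess with constant $\underline{\sigma}\in(0,1)$, let the parameters $c_1,\beta,c_2,\bar\eta,(\eta^k)_{k\ge0}$ satisfy the parameter assumption, and let $\{X^k\}$ be the sequence generated from $X^0$ by the PLAM iteration. Then $\{X^k\}$ has at least one cluster point, and every cluster point is a first-order stationary point of the problem $\min\{f(X):X\in\mathbb{R}^{n\times p},\ X^\top X=I_p\}$. More precisely, for any integer $K>1$, $$\min_{k=0,\dots,K-1}\|\nabla_X\mathcal{L}_\beta(X^k,\Lambda^k)\|_F<\sqrt{\frac{f(X^0)-\underline{f}+MNR+\beta R^2/4}{c_3K}} .$$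
   Context: Notation: $\Psi(A)=\frac12(A+A^\top)$ for square $A$; $\langle A,B\rangle=\mathrm{tr}(A^\top B)$; $\|\cdot\|_F$ Frobenius norm; $\|\cdot\|_2$ spectral (operator) norm; $\sigma_{\min}$ smallest singular value. $\nabla^2 f(X)$ is viewed as a linear operator on $\mathbb{R}^{n\times p}$ with the Frobenius inner product. The augmented Lagrangian is $\mathcal{L}_\beta(X,\Lambda)=f(X)-\frac12\langle\Lambda,X^\top X-I_p\rangle+\frac{\beta}{4}\|X^\top X-I_p\|_F^2$, so $\nabla_X\mathcal{L}_\beta(X,\Lambda)=\nabla f(X)-X\Lambda+\beta X(X^\top X-I_p)$. A point $X$ is a first-order stationary point of $\min\{f(X):X^\top X=I_p\}$ if $X^\top X=I_p$ and $\nabla f(X)-X\nabla f(X)^\top X=0$. PLAM iteration: for $k=0,1,2,\dots$, $\Lambda^k=\Psi(\nabla f(X^k)^\top X^k)$ and $X^{k+1}=X^k-\frac{1}{\eta^k}\nabla_X\mathcal{L}_\beta(X^k,\Lambda^k)$. Qualified initial guess: $X^0$ is a qualified initial guess with constant $\underline{\sigma}\in(0,1)$ if $\sigma_{\min}(X^0)\ge\underline{\sigma}$ and $0<\|{X^0}^\top X^0-I_p\|_F\le 1-\underline{\sigma}^2$. Constants: $R=\|{X^0}^\top X^0-I_p\|_F$; $\mathcal{C}=\{X\in\mathbb{R}^{n\times p}:\|X^\top X-I_p\|_F\le R\}$; $\underline{f}=\min_{X\in\mathcal{C}}f(X)$; $M=\max_{X\in\mathcal{C}}\|X\|_2$; $N=\max_{X\in\mathcal{C}}\|\nabla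 f(X)\|_F$; $L=\max_{X\in\mathcal{C}}\|\nabla^2 f(X)\|_2$. Merit function: $h(X)=f(X)-\frac12\langle\Psi(\nabla f(X)^\top X),X^\top X-I_p\rangle+\frac{\beta}{4}\|X^\top X-I_p\|_F^2$. $L_h>0$ is a constant (depending on $\beta$) such that $\|\nabla h(X)-\nabla h(Y)\|_F\le L_h\|X-Y\|_F$ for all $X,Y\in\mathcal{C}$. $c_3=\frac{c_1}{\bar\eta}-\frac{L_h}{2\bar\eta^2}$, taken to be positive. Parameter assumption: $c_1\in(0,\frac12)$; $$\beta>\max\left\{\frac{MN}{\underline{\sigma}^2}+\sqrt{\frac{M^2N^2}{\underline{\sigma}^4}+\frac{(N+LM)^2}{4\underline{\sigma}^2(1-2c_1)}},\ \frac{MN}{\underline{\sigma}},\ \frac{4MN}{\underline{\sigma}^2}\right\};$$ with $N_L=(1+M^2)N+\beta RM$, $c_2\in\left(0,\frac{R^2(\beta\underline{\sigma}^2-4MN)}{2N_L^2}\right]$; and $\eta^k\in[\underline{\eta},\bar\eta]$ for all $k$, where $$\underline{\eta}=\max\left\{\frac{L_h}{2c_1},\ \frac{2N_LM+N_L\sqrt{4M^2+2R}}{R},\ \frac{R+2M^2}{c_2}\right\},\qquad \bar\eta\ge\underline{\eta}.$$ *)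

theory Defs
  imports "HOL-Analysis.Analysis"
begin

(* An n x p real matrix is an element of real^'p^'n, with n = CARD('n) and p = CARD('p).
   On this type norm is the Frobenius norm and the library inner product is
   <A,B> = tr(A^T B): *)

lemma inner_eq_trace:
  fixes A B :: "real^'p^'n"
  shows "A \<bullet> B = trace (transpose A ** B)"
  unfolding inner_vec_def trace_def matrix_matrix_mult_def transpose_def
  by (simp, rule sum.swap)

lemma norm_eq_sqrt_trace:
  fixes A :: "real^'p^'n"
  shows "norm A = sqrt (trace (transpose A ** A))"
  by (simp add: norm_eq_sqrt_inner inner_eq_trace)

definition sym_part :: "real^'p^'p \<Rightarrow> real^'p^'p" where
  "sym_part A = (1/2) *\<^sub>R (A + transpose A)"

definition spectral_norm :: "real^'p^'n \<Rightarrow> real" where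
  "spectral_norm A = onorm ((*v) A)"

(* The set has p elements counted with multiplicity; these are all the singular values
   of A when p <= n, which is the only case in which it is used. *)
definition singular_values :: "real^'p^'n \<Rightarrow> real set" where
  "singular_values A =
     {s. 0 \<le> s \<and> (\<exists>v. v \<noteq> 0 \<and> (transpose A ** A) *v v = s\<^sup>2 *\<^sub>R v)}"

definition sigma_min :: "real^'p^'n \<Rightarrow> real" where
  "sigma_min A = Min (singular_values A)"

definition grad :: "('a::real_inner \<Rightarrow> real) \<Rightarrow> 'a \<Rightarrow> 'a" where
  "grad f x = (THE g. GDERIV f x :> g)"

lemma grad_eqI:
  assumes "GDERIV f x :> g"
  shows "grad f x = g"
  unfolding grad_def
proof (rule the_equality)
  fix g' assume "GDERIV f x :> g'"
  then have "(\<lambda>h. inner h g') = (\<lambda>h. inner h g)"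
    using assms unfolding gderiv_def by (rule has_derivative_unique)
  then show "g' = g"
    by (metis vector_eq_ldot)
qed (rule assms)

(* As a bounded linear operator, so that norm (hess f x) is its operator norm with respect to
   the norm of 'a; for matrices that is the Frobenius norm. *)
definition hess :: "('a::euclidean_space \<Rightarrow> real) \<Rightarrow> 'a \<Rightarrow> ('a \<Rightarrow>\<^sub>L 'a)" where
  "hess f x = Blinfun (frechet_derivative (grad f) (at x))"

definition twice_cont_diff :: "('a::euclidean_space \<Rightarrow> real) \<Rightarrow> bool" where
  "twice_cont_diff f \<longleftrightarrow>
     (\<forall>x. f differentiable (at x)) \<and>
     (\<forall>x. grad f differentiable (at x)) \<and>
     continuous_on UNIV (hess f)"

definition infeas :: "real^'p^'n \<Rightarrow> real^'p^'p" where
  "infeas X = transpose X ** X - mat 1"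

definition aug_lagrangian ::
  "(real^'p^'n \<Rightarrow> real) \<Rightarrow> real \<Rightarrow> real^'p^'n \<Rightarrow> real^'p^'p \<Rightarrow> real" where
  "aug_lagrangian f \<beta> X \<Lambda> =
     f X - 1/2 * (\<Lambda> \<bullet> infeas X) + \<beta>/4 * (norm (infeas X))\<^sup>2"

definition grad_aug_lagrangian ::
  "(real^'p^'n \<Rightarrow> real) \<Rightarrow> real \<Rightarrow> real^'p^'n \<Rightarrow> real^'p^'p \<Rightarrow> real^'p^'n" where
  "grad_aug_lagrangian f \<beta> X \<Lambda> = grad (\<lambda>Y. aug_lagrangian f \<beta> Y \<Lambda>) X"

definition multiplier :: "(real^'p^'n \<Rightarrow> real) \<Rightarrow> real^'p^'n \<Rightarrow> real^'p^'p" where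
  "multiplier f X = sym_part (transpose (grad f X) ** X)"

definition merit :: "(real^'p^'n \<Rightarrow> real) \<Rightarrow> real \<Rightarrow> real^'p^'n \<Rightarrow> real" where
  "merit f \<beta> X =
     f X - 1/2 * (sym_part (transpose (grad f X) ** X) \<bullet> infeas X)
       + \<beta>/4 * (norm (infeas X))\<^sup>2"

definition first_order_stationary :: "(real^'p^'n \<Rightarrow> real) \<Rightarrow> real^'p^'n \<Rightarrow> bool" where
  "first_order_stationary f X \<longleftrightarrow>
     transpose X ** X = mat 1 \<and> grad f X - X ** transpose (grad f X) ** X = 0"

definition qualified_initial_guess :: "real \<Rightarrow> real^'p^'n \<Rightarrow> bool" where
  "qualified_initial_guess \<sigma> X \<longleftrightarrow>
     \<sigma> \<le> sigma_min X \<and> 0 < norm (infeas X) \<and> norm (infeas X) \<le> 1 - \<sigma>\<^sup>2"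

definition plam_sequence ::
  "(real^'p^'n \<Rightarrow> real) \<Rightarrow> real \<Rightarrow> (nat \<Rightarrow> real) \<Rightarrow> (nat \<Rightarrow> real^'p^'n) \<Rightarrow> bool" where
  "plam_sequence f \<beta> \<eta> X \<longleftrightarrow>
     (\<forall>k. X (Suc k) =
        X k - (1 / \<eta> k) *\<^sub>R grad_aug_lagrangian f \<beta> (X k) (multiplier f (X k)))"

definition cluster_point :: "(nat \<Rightarrow> 'a::topological_space) \<Rightarrow> 'a \<Rightarrow> bool" where
  "cluster_point X l \<longleftrightarrow> (\<exists>r. strict_mono r \<and> (X \<circ> r) \<longlonglongrightarrow> l)"

(* For symmetric \<Lambda>, such as the multipliers of the iteration, the gradient has
   the closed form used to compute the PLAM step. *)
lemma grad_aug_lagrangian_eq: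
  fixes f :: "real^'p^'n \<Rightarrow> real"
  assumes f: "f differentiable (at X)" and sym: "transpose \<Lambda> = \<Lambda>"
  shows "grad_aug_lagrangian f \<beta> X \<Lambda> = grad f X - X ** \<Lambda> + \<beta> *\<^sub>R (X ** infeas X)"
proof -
  obtain f' where f': "(f has_derivative f') (at X)"
    using f by (auto simp: differentiable_def)
  have lin: "bounded_linear f'" using f' by (rule has_derivative_bounded_linear)
  define g where "g = (\<Sum>b\<in>Basis. f' b *\<^sub>R b)"
  have "f' h = h \<bullet> g" for h
  proof -
    interpret bounded_linear f' by (rule lin)
    have "f' h = f' (\<Sum>b\<in>Basis. (h \<bullet> b) *\<^sub>R b)" by (simp add: euclidean_representation)
    also have "\<dots> = (\<Sum>b\<in>Basis. (h \<bullet> b) * f' b)" by (simp add: sum scaleR)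
    finally show ?thesis by (simp add: g_def inner_sum_right mult.commute)
  qed
  then have f'g: "f' = (\<lambda>h. h \<bullet> g)" by auto
  have g: "grad f X = g" using f' by (intro grad_eqI) (simp add: gderiv_def f'g)
  have bil: "bounded_bilinear (\<lambda>(A::real^'p^'n) (B::real^'p^'n). transpose A ** B)"
  proof -
    have "bilinear (\<lambda>(A::real^'p^'n) (B::real^'p^'n). transpose A ** B)"
      unfolding bilinear_def linear_iff
      by (auto simp: vec_eq_iff matrix_matrix_mult_def transpose_def sum.distrib
        algebra_simps sum_distrib_left)
    then show ?thesis by (simp add: bilinear_conv_bounded_bilinear)
  qed
  have dE: "(infeas has_derivative (\<lambda>H. transpose X ** H + transpose H ** X)) (at X)"
    using has_derivative_diff[OF bounded_bilinear.FDERIV[OF bil has_derivative_ident has_derivative_ident]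
      has_derivative_const[of "mat 1"]]
    by (simp add: infeas_def[abs_def])
  have adj: "S \<bullet> (transpose X ** H + transpose H ** X) = 2 * (H \<bullet> (X ** S))"
    if "transpose S = S" for S :: "real^'p^'p" and H :: "real^'p^'n"
  proof -
    have S: "S $ i $ j = S $ j $ i" for i j
      using that by (metis transpose_def vec_lambda_beta)
    have 1: "S \<bullet> (transpose X ** H) = H \<bullet> (X ** S)"
    proof -
      have "S \<bullet> (transpose X ** H) = trace ((S ** transpose X) ** H)"
        by (simp add: inner_eq_trace that matrix_mul_assoc)
      also have "S ** transpose X = transpose (X ** S)"
        by (simp add: matrix_transpose_mul that)
      also have "trace (transpose (X ** S) ** H) = (X ** S) \<bullet> H" by (simp add: inner_eq_trace)
      finally show ?thesis by (simp add: inner_commute)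
    qed
    have "S \<bullet> (transpose H ** X) = trace (X ** (S ** transpose H))"
      by (metis inner_eq_trace that matrix_mul_assoc trace_mul_sym)
    also have "\<dots> = trace (transpose H ** (X ** S))"
      by (metis matrix_mul_assoc trace_mul_sym)
    finally have 2: "S \<bullet> (transpose H ** X) = H \<bullet> (X ** S)" by (simp add: inner_eq_trace)
    show ?thesis by (simp add: inner_add_right 1 2)
  qed
  have symE: "transpose (infeas X) = infeas X"
  proof -
    have "transpose (A - B) = transpose A - transpose B" for A B :: "real^'p^'p"
      by (simp add: transpose_def vec_eq_iff)
    then show ?thesis
      by (simp add: infeas_def matrix_transpose_mul transpose_mat)
  qed
  have "((\<lambda>Y. f Y - 1/2 * (\<Lambda> \<bullet> infeas Y) + \<beta>/4 * (infeas Y \<bullet> infeas Y)) has_derivative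
    (\<lambda>H. H \<bullet> g - 1/2 * (\<Lambda> \<bullet> (transpose X ** H + transpose H ** X))
       + \<beta>/4 * (2 * (infeas X \<bullet> (transpose X ** H + transpose H ** X))))) (at X)"
    by (rule derivative_eq_intros dE f'[unfolded f'g] refl)+ (simp add: inner_commute)
  then have "GDERIV (\<lambda>Y. aug_lagrangian f \<beta> Y \<Lambda>) X :>
      g - X ** \<Lambda> + \<beta> *\<^sub>R (X ** infeas X)"
    unfolding gderiv_def aug_lagrangian_def power2_norm_eq_inner adj[OF sym] adj[OF symE]
    by (simp add: inner_diff_right inner_add_right)
  then show ?thesis unfolding grad_aug_lagrangian_def g by (rule grad_eqI)
qed

end

theory Submission
  imports Defs
begin

text \<open>Write \<open>E = X\<^sup>T X - I\<close> and split the PLAM direction \<open>D\<close> into \<open>T = \<nabla>f(X) - X \<Lambda>\<close> and the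
  normal part \<open>\<beta> X E\<close>; these are nearly orthogonal, as \<open>T \<bullet> X E = - (E \<Lambda>) \<bullet> E\<close>. The
  linear part of the step contracts \<open>E\<close>, which dominates the quadratic remainder, so short steps
  along \<open>- D\<close> stay in \<open>\<C>\<close>. The gradient of the merit function differs from \<open>D\<close> by a
  multiple of \<open>E\<close>, and \<open>\<beta>\<close> is so large that \<open>E\<close> is controlled by the normal part of \<open>D\<close>.
  Hence a potential close to the merit function decreases by more than \<open>c\<^sub>3 \<parallel>D\<parallel>\<^sup>2\<close> per step.
  Summing gives the rate and \<open>D \<rightarrow> 0\<close>, and \<open>D = 0\<close> forces \<open>E = 0\<close> and stationarity.\<close>

section \<open>Matrix products, transposes and norms\<close>

lemma bounded_bilinear_matrix_mult:
  "bounded_bilinear (\<lambda>(A::real^'m^'n) (B::real^'p^'m). A ** B)"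
proof -
  have "bilinear (\<lambda>(A::real^'m^'n) (B::real^'p^'m). A ** B)"
    unfolding bilinear_def linear_iff
    by (auto simp: vec_eq_iff matrix_matrix_mult_def sum.distrib algebra_simps sum_distrib_left)
  then show ?thesis by (simp add: bilinear_conv_bounded_bilinear)
qed

lemma bounded_linear_transpose: "bounded_linear (transpose :: real^'p^'n \<Rightarrow> real^'n^'p)"
  unfolding linear_conv_bounded_linear[symmetric] linear_iff
  by (auto simp: vec_eq_iff transpose_def)

lemmas matrix_mult_bilinear_simps =
  bounded_bilinear.add_left[OF bounded_bilinear_matrix_mult]
  bounded_bilinear.add_right[OF bounded_bilinear_matrix_mult]
  bounded_bilinear.diff_left[OF bounded_bilinear_matrix_mult]
  bounded_bilinear.diff_right[OF bounded_bilinear_matrix_mult]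
  bounded_bilinear.scaleR_left[OF bounded_bilinear_matrix_mult]
  bounded_bilinear.scaleR_right[OF bounded_bilinear_matrix_mult]

lemmas transpose_linear_simps =
  linear_add[OF bounded_linear.linear[OF bounded_linear_transpose]]
  linear_diff[OF bounded_linear.linear[OF bounded_linear_transpose]]
  linear_scale[OF bounded_linear.linear[OF bounded_linear_transpose]]

lemmas continuous_on_matrix_mult = bounded_bilinear.continuous_on[OF bounded_bilinear_matrix_mult]
lemmas continuous_on_transpose = bounded_linear.continuous_on[OF bounded_linear_transpose]

lemma inner_transpose_transpose:
  fixes A B :: "real^'p^'n"
  shows "transpose A \<bullet> transpose B = A \<bullet> B"
  unfolding inner_vec_def transpose_def by (simp, rule sum.swap)

lemma norm_transpose:
  fixes A :: "real^'p^'n"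
  shows "norm (transpose A) = norm A"
  by (simp add: norm_eq_sqrt_inner inner_transpose_transpose)

lemma inner_matrix_mult_left:
  fixes X :: "real^'m^'n" and A :: "real^'p^'n" and B :: "real^'p^'m"
  shows "A \<bullet> (X ** B) = (transpose X ** A) \<bullet> B"
  by (simp add: inner_eq_trace matrix_transpose_mul matrix_mul_assoc)

lemma inner_matrix_mult_right:
  fixes X :: "real^'m^'n" and A :: "real^'p^'n" and B :: "real^'p^'m"
  shows "A \<bullet> (X ** B) = (A ** transpose B) \<bullet> X"
proof -
  have "A \<bullet> (X ** B) = transpose A \<bullet> (transpose B ** transpose X)"
    by (simp add: inner_transpose_transpose flip: matrix_transpose_mul)
  also have "\<dots> = transpose (A ** transpose B) \<bullet> transpose X"
    by (simp add: inner_matrix_mult_left matrix_transpose_mul)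
  finally show ?thesis by (simp only: inner_transpose_transpose)
qed

lemma inner_eq_sum_columns:
  fixes A B :: "real^'p^'n"
  shows "A \<bullet> B = (\<Sum>j\<in>UNIV. column j A \<bullet> column j B)"
  unfolding inner_vec_def column_def by (simp, rule sum.swap)

lemma column_matrix_mult: "column j ((A::real^'m^'n) ** B) = A *v column j B"
  by (simp add: vec_eq_iff column_def matrix_matrix_mult_def matrix_vector_mult_def)

text \<open>A product acts column by column, and the squared Frobenius norm is the sum of the
  squared column norms. An arbitrary vector bound \<open>c\<close> is allowed so that both the
  spectral and the Frobenius estimate follow.\<close>

lemma norm_matrix_mult_le_column_bound:
  fixes X :: "real^'m^'n" and B :: "real^'p^'m"
  assumes "\<And>v. norm (X *v v) \<le> c * norm v" "0 \<le> c"
  shows "norm (X ** B) \<le> c * norm B"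
proof -
  have "(norm (X ** B))\<^sup>2 = (\<Sum>j\<in>UNIV. (norm (X *v column j B))\<^sup>2)"
    by (simp add: power2_norm_eq_inner inner_eq_sum_columns column_matrix_mult)
  also have "\<dots> \<le> (\<Sum>j\<in>UNIV. (c * norm (column j B))\<^sup>2)"
    by (intro sum_mono power_mono assms) auto
  also have "\<dots> = (c * norm B)\<^sup>2"
    by (simp add: power_mult_distrib power2_norm_eq_inner inner_eq_sum_columns[of B]
        sum_distrib_left)
  finally show ?thesis
    by (rule power2_le_imp_le) (simp add: assms(2))
qed

lemma norm_matrix_vector_mult_le:
  fixes A :: "real^'m^'n"
  shows "norm (A *v v) \<le> norm A * norm v"
proof -
  have "(norm (A *v v))\<^sup>2 = (\<Sum>i\<in>UNIV. ((A *v v) $ i)\<^sup>2)"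
    unfolding power2_norm_eq_inner inner_vec_def by (simp add: power2_eq_square)
  also have "\<dots> = (\<Sum>i\<in>UNIV. (A $ i \<bullet> v)\<^sup>2)"
    by (simp add: matrix_vector_mul_component)
  also have "\<dots> \<le> (\<Sum>i\<in>UNIV. (norm (A $ i) * norm v)\<^sup>2)"
  proof (rule sum_mono)
    fix i show "(A $ i \<bullet> v)\<^sup>2 \<le> (norm (A $ i) * norm v)\<^sup>2"
      using power_mono[OF Cauchy_Schwarz_ineq2[of "A $ i" v], of 2] by simp
  qed
  also have "\<dots> = (norm A * norm v)\<^sup>2"
    by (simp add: power_mult_distrib power2_norm_eq_inner inner_vec_def[of A A] sum_distrib_right)
  finally show ?thesis
    by (rule power2_le_imp_le) simp
qed

lemma norm_matrix_mult_le:
  fixes A :: "real^'m^'n" and B :: "real^'p^'m"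
  shows "norm (A ** B) \<le> norm A * norm B"
  by (rule norm_matrix_mult_le_column_bound) (simp_all add: norm_matrix_vector_mult_le)

lemma norm_matrix_vector_mult_le_spectral:
  "norm (X *v v) \<le> spectral_norm X * norm v"
  unfolding spectral_norm_def by (rule onorm) (rule matrix_vector_mul_bounded_linear)

lemma spectral_norm_nonneg: "0 \<le> spectral_norm X"
  unfolding spectral_norm_def by (rule onorm_pos_le) (rule matrix_vector_mul_bounded_linear)

lemma spectral_norm_le_norm: "spectral_norm X \<le> norm X"
  unfolding spectral_norm_def
  by (rule onorm_le) (rule norm_matrix_vector_mult_le)

lemma norm_matrix_mult_le_spectral:
  fixes X :: "real^'m^'n" and B :: "real^'p^'m"
  assumes "spectral_norm X \<le> M"
  shows "norm (X ** B) \<le> M * norm B"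
proof -
  have "norm (X ** B) \<le> spectral_norm X * norm B"
    by (rule norm_matrix_mult_le_column_bound)
      (auto simp: norm_matrix_vector_mult_le_spectral spectral_norm_nonneg)
  also have "\<dots> \<le> M * norm B" by (rule mult_right_mono) (use assms in auto)
  finally show ?thesis .
qed

text \<open>Moving the transpose across the inner product writes the squared norm of the product as
  \<open>B\<close> paired with \<open>X\<close> times the product. Cauchy-Schwarz and one
  cancellation then suffice, and the spectral norm of the transpose is never compared with that of
  \<open>X\<close>.\<close>

lemma norm_transpose_matrix_mult_le_spectral:
  fixes X :: "real^'m^'n" and B :: "real^'p^'n"
  assumes "spectral_norm X \<le> M"
  shows "norm (transpose X ** B) \<le> M * norm B"
proof (cases "norm (transpose X ** B) = 0")
  case True
  have "0 \<le> M" using assms spectral_norm_nonneg[of X] by linarith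
  then show ?thesis using True by simp
next
  case False
  let ?A = "transpose X ** B"
  have "norm ?A * norm ?A = B \<bullet> (X ** ?A)"
    by (simp add: inner_matrix_mult_left flip: power2_norm_eq_inner power2_eq_square)
  also have "\<dots> \<le> norm B * (M * norm ?A)"
    by (rule order_trans[OF norm_cauchy_schwarz])
       (intro mult_left_mono norm_matrix_mult_le_spectral assms norm_ge_zero)
  finally show ?thesis using False by (simp add: mult.assoc[symmetric] mult.commute)
qed

section \<open>Symmetric parts\<close>

lemma transpose_sym_part: "transpose (sym_part A) = sym_part A"
  by (simp add: sym_part_def transpose_linear_simps add.commute)

lemma sym_part_transpose: "sym_part (transpose A) = sym_part A"
  by (simp add: sym_part_def add.commute)

lemma sym_part_eq: "transpose A = A \<Longrightarrow> sym_part A = A"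
  by (simp add: sym_part_def flip: scaleR_2)

text \<open>Symmetric matrices are orthogonal to skew-symmetric ones.\<close>

lemma inner_sym_part:
  assumes "transpose S = S"
  shows "sym_part A \<bullet> S = A \<bullet> S"
  using inner_transpose_transpose[of A S] assms
  by (simp add: sym_part_def inner_add_left)

lemma norm_sym_part_le: "norm (sym_part A) \<le> norm A"
proof -
  have "norm (sym_part A) \<le> (1/2) * (norm A + norm (transpose A))"
    unfolding sym_part_def norm_scaleR by (simp add: norm_triangle_ineq)
  then show ?thesis by (simp add: norm_transpose)
qed

lemma sym_part_add: "sym_part (A + B) = sym_part A + sym_part B"
  by (simp add: sym_part_def transpose_linear_simps algebra_simps)

lemma sym_part_diff: "sym_part (A - B) = sym_part A - sym_part B"
  by (simp add: sym_part_def transpose_linear_simps algebra_simps)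

lemma sym_part_scaleR: "sym_part (c *\<^sub>R A) = c *\<^sub>R sym_part A"
  by (simp add: sym_part_def transpose_linear_simps algebra_simps)

section \<open>The infeasibility matrix and its sublevel sets\<close>

lemma transpose_infeas: "transpose (infeas X) = infeas X"
  by (simp add: infeas_def matrix_transpose_mul transpose_linear_simps transpose_mat)

lemma gram_eq_infeas: "transpose X ** X = infeas X + mat 1"
  by (simp add: infeas_def)

lemma continuous_on_infeas: "continuous_on A infeas"
  unfolding infeas_def[abs_def]
  by (intro continuous_intros continuous_on_matrix_mult continuous_on_transpose)

lemma infeas_step:
  "infeas (X - t *\<^sub>R D)
     = infeas X - (2 * t) *\<^sub>R sym_part (transpose X ** D) + t\<^sup>2 *\<^sub>R (transpose D ** D)"
proof -
  have "(2 * t) *\<^sub>R sym_part (transpose X ** D)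
      = t *\<^sub>R (transpose X ** D) + t *\<^sub>R (transpose D ** X)"
    by (simp add: sym_part_def scaleR_add_right matrix_transpose_mul)
  then show ?thesis
    by (simp add: infeas_def matrix_mult_bilinear_simps transpose_linear_simps
        matrix_transpose_mul power2_eq_square scaleR_diff_right)
qed

text \<open>Expanding at the midpoint \<open>Z\<close> of the step absorbs the quadratic term: the
  new infeasibility is exactly \<open>E - (2 * t) *\<^sub>R S\<close> with \<open>S\<close> the
  symmetric part of \<open>transpose Z ** D\<close>. Returning from \<open>Z\<close> to
  \<open>X\<close> in the cross term costs the summand with \<open>R\<close>, and the square of
  \<open>S\<close> costs the one with \<open>M\<^sup>2\<close>.\<close>

lemma norm_infeas_sq_step_le:
  assumes M: "spectral_norm (X - (t/2) *\<^sub>R D) \<le> M" and R: "norm (infeas X) \<le> R"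
  shows "(norm (infeas (X - t *\<^sub>R D)))\<^sup>2
    \<le> (norm (infeas X))\<^sup>2 - 4 * t * ((X ** infeas X) \<bullet> D) + 2 * t\<^sup>2 * (R + 2 * M\<^sup>2) * (norm D)\<^sup>2"
proof -
  define Z where "Z = X - (t/2) *\<^sub>R D"
  define E where "E = infeas X"
  define S where "S = sym_part (transpose Z ** D)"
  have "transpose Z ** D = transpose X ** D - (t/2) *\<^sub>R (transpose D ** D)"
    by (simp add: Z_def matrix_mult_bilinear_simps transpose_linear_simps)
  then have "S = sym_part (transpose X ** D) - (t/2) *\<^sub>R (transpose D ** D)"
    by (simp add: S_def sym_part_diff sym_part_scaleR sym_part_eq matrix_transpose_mul)
  then have diff: "infeas (X - t *\<^sub>R D) = E - (2 * t) *\<^sub>R S"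
    by (simp add: infeas_step E_def scaleR_diff_right power2_eq_square)
  have "norm S \<le> M * norm D"
    unfolding S_def Z_def
    by (rule order_trans[OF norm_sym_part_le norm_transpose_matrix_mult_le_spectral[OF M]])
  then have S: "(norm S)\<^sup>2 \<le> M\<^sup>2 * (norm D)\<^sup>2"
    by (metis norm_ge_zero power_mono power_mult_distrib)
  have "E \<bullet> S = E \<bullet> (transpose Z ** D)"
    unfolding S_def by (metis E_def inner_commute inner_sym_part transpose_infeas)
  also have "\<dots> = (X ** E) \<bullet> D - (t/2) * (E \<bullet> (transpose D ** D))"
    by (simp add: Z_def matrix_mult_bilinear_simps transpose_linear_simps inner_diff_right
        inner_matrix_mult_left)
  finally have ES: "E \<bullet> S = (X ** E) \<bullet> D - (t/2) * (E \<bullet> (transpose D ** D))" .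
  have "E \<bullet> (transpose D ** D) \<le> norm E * (norm D * norm D)"
    by (rule order_trans[OF norm_cauchy_schwarz])
      (metis mult_left_mono norm_ge_zero norm_matrix_mult_le norm_transpose)
  also have "\<dots> \<le> R * (norm D)\<^sup>2"
    using R by (simp add: E_def power2_eq_square mult_right_mono)
  finally have ED: "E \<bullet> (transpose D ** D) \<le> R * (norm D)\<^sup>2" .
  have "(norm (infeas (X - t *\<^sub>R D)))\<^sup>2 = (norm E)\<^sup>2 - 4 * t * (E \<bullet> S) + 4 * t\<^sup>2 * (norm S)\<^sup>2"
    unfolding diff power2_norm_eq_inner
    by (simp add: inner_diff_left inner_diff_right inner_commute power2_eq_square)
  also have "\<dots> = (norm E)\<^sup>2 - 4 * t * ((X ** E) \<bullet> D)
      + t\<^sup>2 * (2 * (E \<bullet> (transpose D ** D)) + 4 * (norm S)\<^sup>2)"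
    by (simp add: ES algebra_simps power2_eq_square)
  also have "\<dots> \<le> (norm E)\<^sup>2 - 4 * t * ((X ** E) \<bullet> D)
      + t\<^sup>2 * (2 * (R * (norm D)\<^sup>2) + 4 * (M\<^sup>2 * (norm D)\<^sup>2))"
    using ED S by (intro add_left_mono mult_left_mono add_mono) auto
  finally show ?thesis by (simp add: E_def algebra_simps)
qed

text \<open>With E = \<open>infeas X\<close>, the Gram matrix is I + E, so the right side equals the
  squared norm of E plus a cubic term in E. This converts the normal part of the direction into a
  measure of infeasibility.\<close>

lemma norm_matrix_mult_infeas_ge:
  "(1 - norm (infeas X)) * (norm (infeas X))\<^sup>2 \<le> (norm (X ** infeas X))\<^sup>2"
proof -
  let ?E = "infeas X"
  have "(norm (X ** ?E))\<^sup>2 = (transpose X ** (X ** ?E)) \<bullet> ?E"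
    by (simp add: power2_norm_eq_inner inner_matrix_mult_left)
  also have "\<dots> = (norm ?E)\<^sup>2 + (?E ** ?E) \<bullet> ?E"
    by (simp add: matrix_mul_assoc gram_eq_infeas matrix_mult_bilinear_simps
        inner_add_left power2_norm_eq_inner)
  finally have eq: "(norm (X ** ?E))\<^sup>2 = (norm ?E)\<^sup>2 + (?E ** ?E) \<bullet> ?E" .
  have "\<bar>(?E ** ?E) \<bullet> ?E\<bar> \<le> norm ?E * norm ?E * norm ?E"
    by (rule order_trans[OF Cauchy_Schwarz_ineq2])
       (intro mult_right_mono norm_matrix_mult_le norm_ge_zero)
  then show ?thesis unfolding eq by (simp add: algebra_simps power2_eq_square)
qed

text \<open>Evaluating the Gram matrix I + E at a single unit vector suffices. This later bounds
  \<open>M\<close> away from zero.\<close>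

lemma one_minus_norm_infeas_le_spectral_norm:
  fixes X :: "real^'p^'n"
  shows "1 - norm (infeas X) \<le> (spectral_norm X)\<^sup>2"
proof -
  obtain v :: "real^'p" where v: "norm v = 1" using vector_choose_size[of 1] by auto
  have "(norm (X *v v))\<^sup>2 = v \<bullet> ((transpose X ** X) *v v)"
    by (metis dot_lmul_matrix matrix_vector_mul_assoc power2_norm_eq_inner transpose_matrix_vector
        inner_commute)
  also have "\<dots> = 1 + v \<bullet> (infeas X *v v)"
    using v by (simp add: gram_eq_infeas matrix_vector_mult_add_rdistrib inner_add_right
        flip: power2_norm_eq_inner)
  finally have eq: "(norm (X *v v))\<^sup>2 = 1 + v \<bullet> (infeas X *v v)" .
  have "\<bar>v \<bullet> (infeas X *v v)\<bar> \<le> norm (infeas X)"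
    using order_trans[OF Cauchy_Schwarz_ineq2[of v "infeas X *v v"]]
      norm_matrix_vector_mult_le[of "infeas X" v] v by simp
  moreover have "(norm (X *v v))\<^sup>2 \<le> (spectral_norm X)\<^sup>2"
    using power_mono[OF norm_matrix_vector_mult_le_spectral[of X v], of 2] v by simp
  ultimately show ?thesis using eq by linarith
qed

text \<open>The squared norm is the trace of the Gram matrix, hence an inner product with the
  identity. This makes the sublevel sets of the infeasibility bounded.\<close>

lemma norm_sq_le_infeas:
  fixes X :: "real^'p^'n"
  shows "(norm X)\<^sup>2 \<le> norm (mat 1 :: real^'p^'p) * (norm (infeas X) + norm (mat 1 :: real^'p^'p))"
proof -
  have "(norm X)\<^sup>2 = (mat 1 :: real^'p^'p) \<bullet> (infeas X + mat 1)"
    by (simp add: power2_norm_eq_inner inner_eq_trace transpose_mat flip: gram_eq_infeas)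
  also have "\<dots> \<le> norm (mat 1 :: real^'p^'p) * norm (infeas X + mat 1)"
    by (rule norm_cauchy_schwarz)
  also have "\<dots> \<le> norm (mat 1 :: real^'p^'p) * (norm (infeas X) + norm (mat 1 :: real^'p^'p))"
    by (intro mult_left_mono norm_triangle_ineq norm_ge_zero)
  finally show ?thesis .
qed

lemma compact_infeas_le: "compact {X :: real^'p^'n. norm (infeas X) \<le> R}"
proof -
  let ?C = "{X :: real^'p^'n. norm (infeas X) \<le> R}"
  let ?m = "norm (mat 1 :: real^'p^'p)"
  have "closed ?C"
    by (intro closed_Collect_le continuous_intros continuous_on_infeas)
  moreover have "bounded ?C"
  proof (rule boundedI)
    fix X :: "real^'p^'n" assume "X \<in> ?C"
    then have "?m * (norm (infeas X) + ?m) \<le> ?m * (R + ?m)" by (simp add: mult_left_mono)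
    with norm_sq_le_infeas[of X] have "(norm X)\<^sup>2 \<le> ?m * (R + ?m)" by linarith
    then show "norm X \<le> sqrt (?m * (R + ?m))" by (rule real_le_rsqrt)
  qed
  ultimately show ?thesis by (simp add: compact_eq_bounded_closed)
qed

section \<open>Gradients, Hessians and descent along a segment\<close>

text \<open>The Riesz representative, written in the standard basis, is the witness that the
  definite description in \<open>grad\<close> needs.\<close>

lemma inner_grad_eq_derivative:
  fixes f :: "'a::euclidean_space \<Rightarrow> real"
  assumes f': "(f has_derivative f') (at x)"
  shows "h \<bullet> grad f x = f' h"
proof -
  interpret bounded_linear f' using f' by (rule has_derivative_bounded_linear)
  define g where "g = (\<Sum>b\<in>Basis. f' b *\<^sub>R b)"
  have f'g: "f' h = h \<bullet> g" for h
  proof -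
    have "f' h = f' (\<Sum>b\<in>Basis. (h \<bullet> b) *\<^sub>R b)" by (simp add: euclidean_representation)
    also have "\<dots> = (\<Sum>b\<in>Basis. (h \<bullet> b) * f' b)" by (simp add: sum scaleR)
    finally show ?thesis by (simp add: g_def inner_sum_right mult.commute)
  qed
  then have "f' = (\<lambda>h. h \<bullet> g)" by auto
  then have "grad f x = g" using f' by (intro grad_eqI) (simp add: gderiv_def)
  with f'g show ?thesis by simp
qed

lemma has_derivative_grad:
  fixes f :: "'a::euclidean_space \<Rightarrow> real"
  assumes "f differentiable (at x)"
  shows "(f has_derivative (\<lambda>h. h \<bullet> grad f x)) (at x)"
proof -
  obtain f' where "(f has_derivative f') (at x)"
    using assms by (auto simp: differentiable_def)
  moreover from inner_grad_eq_derivative[OF this] have "f' = (\<lambda>h. h \<bullet> grad f x)" by auto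
  ultimately show ?thesis by simp
qed

lemma grad_has_derivative_hess:
  assumes "grad f differentiable (at x)"
  shows "(grad f has_derivative blinfun_apply (hess f x)) (at x)"
proof -
  from assms have "(grad f has_derivative frechet_derivative (grad f) (at x)) (at x)"
    by (simp add: frechet_derivative_works)
  then show ?thesis
    by (simp add: hess_def bounded_linear_Blinfun_apply has_derivative_bounded_linear)
qed

lemma twice_cont_diff_continuous_grad:
  "twice_cont_diff f \<Longrightarrow> continuous_on A (grad f)"
  by (auto simp: twice_cont_diff_def intro: differentiable_at_imp_differentiable_on
      differentiable_imp_continuous_on continuous_on_subset)

text \<open>The remainder is controlled after subtracting the quadratic model from the restriction
  of \<open>h\<close> to the segment, which makes that restriction nonincreasing.\<close>

lemma descent_along_segment:
  fixes h :: "'a::euclidean_space \<Rightarrow> real"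
  assumes diff: "\<And>u. 0 \<le> u \<Longrightarrow> u \<le> t \<Longrightarrow> h differentiable (at (x - u *\<^sub>R d))"
    and lip: "\<And>u. 0 \<le> u \<Longrightarrow> u \<le> t \<Longrightarrow> norm (grad h (x - u *\<^sub>R d) - grad h x) \<le> L * (u * norm d)"
    and t: "0 \<le> t"
  shows "h (x - t *\<^sub>R d) \<le> h x - t * (grad h x \<bullet> d) + L / 2 * t\<^sup>2 * (norm d)\<^sup>2"
proof -
  define \<psi> where "\<psi> u = h (x - u *\<^sub>R d) + u * (grad h x \<bullet> d) - L / 2 * u\<^sup>2 * (norm d)\<^sup>2" for u
  have "\<psi> t \<le> \<psi> 0"
  proof (rule DERIV_nonpos_imp_nonincreasing[OF t])
    fix u assume u: "0 \<le> u" "u \<le> t"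
    have "((\<lambda>v. h (x - v *\<^sub>R d)) has_derivative (\<lambda>v. (- (v *\<^sub>R d)) \<bullet> grad h (x - u *\<^sub>R d))) (at u)"
      by (rule has_derivative_compose[where f = "\<lambda>v. x - v *\<^sub>R d", OF _ has_derivative_grad[OF diff[OF u]]])
        (auto intro!: derivative_eq_intros)
    then have D: "((\<lambda>v. h (x - v *\<^sub>R d)) has_real_derivative - (d \<bullet> grad h (x - u *\<^sub>R d))) (at u)"
      unfolding has_field_derivative_def
      by (rule has_derivative_eq_rhs) (auto simp: mult.commute)
    have "(\<psi> has_real_derivative - (d \<bullet> grad h (x - u *\<^sub>R d)) + grad h x \<bullet> d - L * u * (norm d)\<^sup>2) (at u)"
      unfolding \<psi>_def[abs_def] by (rule derivative_eq_intros D refl | simp)+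
    moreover have "- (d \<bullet> grad h (x - u *\<^sub>R d)) + grad h x \<bullet> d - L * u * (norm d)\<^sup>2 \<le> 0"
    proof -
      have "grad h x \<bullet> d - d \<bullet> grad h (x - u *\<^sub>R d) \<le> norm (grad h (x - u *\<^sub>R d) - grad h x) * norm d"
        using norm_cauchy_schwarz[of "grad h x - grad h (x - u *\<^sub>R d)" d]
        by (simp add: inner_diff_left inner_diff_right inner_commute norm_minus_commute)
      also have "\<dots> \<le> L * (u * norm d) * norm d"
        by (intro mult_right_mono lip u) auto
      finally show ?thesis by (simp add: power2_eq_square algebra_simps)
    qed
    ultimately show "\<exists>y. (\<psi> has_real_derivative y) (at u) \<and> y \<le> 0" by blast
  qed
  then show ?thesis by (simp add: \<psi>_def)
qed

section \<open>The derivative of the merit function\<close>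

lemma infeas_has_derivative:
  "(infeas has_derivative (\<lambda>H. transpose X ** H + transpose H ** X)) (at X)"
  unfolding infeas_def[abs_def]
  by (rule derivative_eq_intros bounded_bilinear.FDERIV[OF bounded_bilinear_matrix_mult]
      bounded_linear.has_derivative[OF bounded_linear_transpose] has_derivative_ident refl)+
    simp

lemma inner_sym_infeas_derivative:
  fixes X H :: "real^'p^'n" and S :: "real^'p^'p"
  assumes "transpose S = S"
  shows "S \<bullet> (transpose X ** H + transpose H ** X) = 2 * (H \<bullet> (X ** S))"
proof -
  have 1: "S \<bullet> (transpose X ** H) = H \<bullet> (X ** S)"
    unfolding inner_matrix_mult_left[of H] by (rule inner_commute)
  have "S \<bullet> (transpose H ** X) = S \<bullet> (transpose X ** H)"
    using inner_transpose_transpose[of S "transpose H ** X"] assms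
    by (simp add: matrix_transpose_mul)
  with 1 show ?thesis by (simp add: inner_add_right)
qed

text \<open>The first inner product pairs \<open>H\<close> with the PLAM direction. The other two
  come from differentiating the multiplier and both carry the factor \<open>infeas X\<close>, so
  they are small near feasibility.\<close>

lemma merit_has_derivative:
  fixes f :: "real^'p^'n \<Rightarrow> real"
  assumes f: "twice_cont_diff f"
  shows "(merit f \<beta> has_derivative (\<lambda>H.
      H \<bullet> (grad f X - X ** multiplier f X + \<beta> *\<^sub>R (X ** infeas X))
      - 1/2 * (hess f X H \<bullet> (X ** infeas X)) - 1/2 * (H \<bullet> (grad f X ** infeas X)))) (at X)"
    (is "(_ has_derivative ?D) _")
proof -
  let ?E' = "\<lambda>H. transpose X ** H + transpose H ** X"
  have merit_eq: "merit f \<beta> = (\<lambda>Y. f Y - 1/2 * (grad f Y \<bullet> (Y ** infeas Y))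
      + \<beta>/4 * (infeas Y \<bullet> infeas Y))"
  proof
    fix Y
    have "sym_part (transpose (grad f Y) ** Y) \<bullet> infeas Y = (transpose Y ** grad f Y) \<bullet> infeas Y"
      using sym_part_transpose[of "transpose Y ** grad f Y"]
      by (simp add: matrix_transpose_mul inner_sym_part transpose_infeas)
    also have "\<dots> = grad f Y \<bullet> (Y ** infeas Y)"
      by (simp add: inner_matrix_mult_left)
    finally show "merit f \<beta> Y = f Y - 1/2 * (grad f Y \<bullet> (Y ** infeas Y))
      + \<beta>/4 * (infeas Y \<bullet> infeas Y)"
      by (simp add: merit_def power2_norm_eq_inner)
  qed
  have df: "(f has_derivative (\<lambda>h. h \<bullet> grad f X)) (at X)"
    using f by (intro has_derivative_grad) (simp add: twice_cont_diff_def)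
  have dg: "(grad f has_derivative blinfun_apply (hess f X)) (at X)"
    using f by (intro grad_has_derivative_hess) (simp add: twice_cont_diff_def)
  have dXE: "((\<lambda>Y. Y ** infeas Y) has_derivative (\<lambda>H. X ** ?E' H + H ** infeas X)) (at X)"
    by (rule bounded_bilinear.FDERIV[OF bounded_bilinear_matrix_mult has_derivative_ident
          infeas_has_derivative])
  have "(merit f \<beta> has_derivative (\<lambda>H. H \<bullet> grad f X
      - 1/2 * (grad f X \<bullet> (X ** ?E' H + H ** infeas X) + hess f X H \<bullet> (X ** infeas X))
      + \<beta>/4 * (infeas X \<bullet> ?E' H + ?E' H \<bullet> infeas X))) (at X)" (is "(_ has_derivative ?D') _")
    unfolding merit_eq
    by (intro has_derivative_add has_derivative_diff has_derivative_mult_right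
        has_derivative_inner df dg dXE infeas_has_derivative)
  also have "?D' = ?D"
  proof
    fix H
    have "grad f X \<bullet> (X ** ?E' H) = (transpose X ** grad f X) \<bullet> ?E' H"
      by (rule inner_matrix_mult_left)
    also have "\<dots> = multiplier f X \<bullet> ?E' H"
    proof -
      have "transpose (?E' H) = ?E' H"
        by (simp add: transpose_linear_simps matrix_transpose_mul)
      from inner_sym_part[OF this, of "transpose X ** grad f X"] show ?thesis
        using sym_part_transpose[of "transpose X ** grad f X"]
        by (simp add: multiplier_def matrix_transpose_mul)
    qed
    also have "\<dots> = 2 * (H \<bullet> (X ** multiplier f X))"
      by (rule inner_sym_infeas_derivative) (simp add: multiplier_def transpose_sym_part)
    finally have 1: "grad f X \<bullet> (X ** ?E' H) = 2 * (H \<bullet> (X ** multiplier f X))" .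
    have 2: "infeas X \<bullet> ?E' H = 2 * (H \<bullet> (X ** infeas X))"
      by (rule inner_sym_infeas_derivative) (rule transpose_infeas)
    have 3: "grad f X \<bullet> (H ** infeas X) = H \<bullet> (grad f X ** infeas X)"
      unfolding inner_matrix_mult_right[of "grad f X" H] transpose_infeas by (rule inner_commute)
    show "?D' H = ?D H"
      unfolding inner_add_right[of "grad f X"] 1 3 inner_commute[of "?E' H" "infeas X"] 2
      by (simp add: inner_add_right inner_diff_right field_simps)
  qed
  finally show ?thesis .
qed

text \<open>Testing the derivative on \<open>D\<close> itself gives the squared norm of
  \<open>D\<close> minus the two multiplier terms, which Cauchy-Schwarz and the operator norm of the
  Hessian control.\<close>

lemma inner_grad_merit_ge:
  fixes f :: "real^'p^'n \<Rightarrow> real"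
  assumes f: "twice_cont_diff f" and M: "spectral_norm X \<le> M"
    and N: "norm (grad f X) \<le> N" and L: "norm (hess f X) \<le> L"
    and D: "D = grad f X - X ** multiplier f X + \<beta> *\<^sub>R (X ** infeas X)"
  shows "grad (merit f \<beta>) X \<bullet> D \<ge> (norm D)\<^sup>2 - (N + L * M) / 2 * norm (infeas X) * norm D"
proof -
  let ?E = "infeas X"
  have "\<bar>hess f X D \<bullet> (X ** ?E)\<bar> \<le> norm (hess f X D) * norm (X ** ?E)"
    by (rule Cauchy_Schwarz_ineq2)
  also have "\<dots> \<le> (L * norm D) * (M * norm ?E)"
  proof (rule mult_mono)
    show "norm (hess f X D) \<le> L * norm D"
      by (rule order_trans[OF norm_blinfun mult_right_mono[OF L norm_ge_zero]])
    then show "0 \<le> L * norm D" by (rule order_trans[OF norm_ge_zero])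
  qed (auto intro: norm_matrix_mult_le_spectral[OF M])
  finally have 1: "\<bar>hess f X D \<bullet> (X ** ?E)\<bar> \<le> L * M * norm ?E * norm D" by (simp add: mult_ac)
  have "\<bar>D \<bullet> (grad f X ** ?E)\<bar> \<le> norm D * (norm (grad f X) * norm ?E)"
    by (rule order_trans[OF Cauchy_Schwarz_ineq2])
      (intro mult_left_mono norm_matrix_mult_le norm_ge_zero)
  also have "\<dots> \<le> norm D * (N * norm ?E)"
    by (intro mult_left_mono mult_right_mono N norm_ge_zero)
  finally have 2: "\<bar>D \<bullet> (grad f X ** ?E)\<bar> \<le> N * norm ?E * norm D" by (simp add: mult_ac)
  have "grad (merit f \<beta>) X \<bullet> D = D \<bullet> D - 1/2 * (hess f X D \<bullet> (X ** ?E)) - 1/2 * (D \<bullet> (grad f X ** ?E))"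
    using inner_grad_eq_derivative[OF merit_has_derivative[OF f], where h = D]
    by (simp add: inner_commute flip: D)
  moreover have "(N + L * M) / 2 * norm ?E * norm D
      = 1/2 * (L * M * norm ?E * norm D) + 1/2 * (N * norm ?E * norm D)"
    by (simp add: field_simps)
  ultimately show ?thesis using 1 2 unfolding power2_norm_eq_inner by linarith
qed

section \<open>The tangent and normal parts of the PLAM direction\<close>

lemma norm_multiplier_le:
  assumes M: "spectral_norm X \<le> M" and N: "norm (grad f X) \<le> N"
  shows "norm (multiplier f X) \<le> M * N"
proof -
  have M0: "0 \<le> M" using M spectral_norm_nonneg[of X] by linarith
  have "norm (multiplier f X) \<le> norm (transpose X ** grad f X)"
    using norm_sym_part_le[of "transpose (grad f X) ** X"]
      norm_transpose[of "transpose X ** grad f X"]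
    by (simp add: multiplier_def matrix_transpose_mul)
  also have "\<dots> \<le> M * norm (grad f X)"
    by (rule norm_transpose_matrix_mult_le_spectral[OF M])
  also have "\<dots> \<le> M * N"
    by (rule mult_left_mono[OF N M0])
  finally show ?thesis .
qed

lemma norm_inner_multiplier_infeas_le:
  assumes "spectral_norm X \<le> M" "norm (grad f X) \<le> N"
  shows "\<bar>multiplier f X \<bullet> infeas X\<bar> \<le> M * N * norm (infeas X)"
  by (rule order_trans[OF Cauchy_Schwarz_ineq2])
    (intro mult_right_mono norm_multiplier_le assms norm_ge_zero)

lemma norm_infeas_multiplier_le:
  assumes "spectral_norm X \<le> M" "norm (grad f X) \<le> N"
  shows "norm (infeas X ** multiplier f X) \<le> M * N * norm (infeas X)"
  by (rule order_trans[OF norm_matrix_mult_le])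
    (subst mult.commute, intro mult_right_mono norm_multiplier_le assms norm_ge_zero)

text \<open>The multiplier is the symmetric part of \<open>transpose X ** grad f X\<close>, so it
  would cancel exactly if the Gram matrix were the identity; only the deviation
  \<open>infeas X\<close> is left.\<close>

lemma sym_part_transpose_mult_tangent:
  "sym_part (transpose X ** (grad f X - X ** multiplier f X))
     = - sym_part (infeas X ** multiplier f X)"
proof -
  have "sym_part (transpose X ** grad f X) = multiplier f X"
    using sym_part_transpose[of "transpose X ** grad f X"]
    by (simp add: multiplier_def matrix_transpose_mul)
  moreover have "sym_part (multiplier f X) = multiplier f X"
    by (rule sym_part_eq) (simp add: multiplier_def transpose_sym_part)
  ultimately show ?thesis
    by (simp add: matrix_mult_bilinear_simps matrix_mul_assoc gram_eq_infeas sym_part_diff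
        sym_part_add)
qed

text \<open>Pairing with the symmetric \<open>infeas X\<close> sees only the symmetric part of
  \<open>transpose X\<close> times the tangent part, which is itself of first order in
  \<open>infeas X\<close>. The cross term is therefore of second order.\<close>

lemma inner_tangent_normal_le:
  assumes "spectral_norm X \<le> M" "norm (grad f X) \<le> N"
  shows "\<bar>(grad f X - X ** multiplier f X) \<bullet> (X ** infeas X)\<bar> \<le> M * N * (norm (infeas X))\<^sup>2"
proof -
  let ?E = "infeas X" and ?T = "grad f X - X ** multiplier f X"
  have "?T \<bullet> (X ** ?E) = sym_part (transpose X ** ?T) \<bullet> ?E"
    by (simp add: inner_matrix_mult_left inner_sym_part transpose_infeas)
  also have "\<dots> = - ((?E ** multiplier f X) \<bullet> ?E)"
    by (simp add: sym_part_transpose_mult_tangent inner_sym_part transpose_infeas)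
  finally have "\<bar>?T \<bullet> (X ** ?E)\<bar> = \<bar>(?E ** multiplier f X) \<bullet> ?E\<bar>" by simp
  also have "\<dots> \<le> (M * N * norm ?E) * norm ?E"
    by (rule order_trans[OF Cauchy_Schwarz_ineq2])
      (intro mult_right_mono norm_infeas_multiplier_le assms norm_ge_zero)
  finally show ?thesis by (simp add: power2_eq_square)
qed

text \<open>The gradient of the augmented Lagrangian at the PLAM multiplier, in the closed form on
  which all estimates are based; \<open>grad_aug_lagrangian_eq_plam_dir\<close> makes the
  identification.\<close>

definition plam_dir :: "(real^'p^'n \<Rightarrow> real) \<Rightarrow> real \<Rightarrow> real^'p^'n \<Rightarrow> real^'p^'n" where
  "plam_dir f \<beta> X = grad f X - X ** multiplier f X + \<beta> *\<^sub>R (X ** infeas X)"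

lemma norm_plam_dir_le:
  assumes M: "spectral_norm X \<le> M" and N: "norm (grad f X) \<le> N"
    and R: "norm (infeas X) \<le> R" and \<beta>: "0 \<le> \<beta>"
  shows "norm (plam_dir f \<beta> X) \<le> (1 + M\<^sup>2) * N + \<beta> * R * M"
proof -
  have M0: "0 \<le> M" using M spectral_norm_nonneg[of X] by linarith
  have "norm (X ** multiplier f X) \<le> M * (M * N)"
    by (rule order_trans[OF norm_matrix_mult_le_spectral[OF M]])
      (intro mult_left_mono norm_multiplier_le M N M0)
  moreover have "norm (\<beta> *\<^sub>R (X ** infeas X)) \<le> \<beta> * (M * R)"
  proof -
    have "norm (X ** infeas X) \<le> M * R"
      by (rule order_trans[OF norm_matrix_mult_le_spectral[OF M]])
        (intro mult_left_mono R M0)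
    then show ?thesis using \<beta> by (simp add: mult_left_mono)
  qed
  moreover have "norm (plam_dir f \<beta> X)
      \<le> norm (grad f X) + norm (X ** multiplier f X) + norm (\<beta> *\<^sub>R (X ** infeas X))"
    unfolding plam_dir_def
    by (intro order_trans[OF norm_triangle_ineq] add_mono norm_triangle_ineq4 order_refl)
  ultimately show ?thesis using N by (simp add: algebra_simps power2_eq_square)
qed

section \<open>Feasibility of short steps\<close>

text \<open>Let \<delta> = \<beta> s - M N. As the norm of E is at most 1 - s, the part of the step
  that is linear in t contracts the bound by the factor 1 - 2 t \<delta>. The smallness of
  \<open>t * B\<^sup>2\<close> lets half of this gain absorb the quadratic remainder.\<close>

lemma plam_step_feasible:
  assumes M: "spectral_norm X \<le> M" and N: "norm (grad f X) \<le> N"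
    and R: "norm (infeas X) \<le> R" and s: "R \<le> 1 - s" "0 \<le> s"
    and \<beta>: "0 \<le> \<beta>" "M * N \<le> \<beta> * s" and D: "norm (plam_dir f \<beta> X) \<le> B"
    and t: "0 \<le> t" "2 * t * \<beta> \<le> 1" "t * B\<^sup>2 \<le> R * (\<beta> * s - M * N)"
  shows "norm (infeas (X - t *\<^sub>R plam_dir f \<beta> X)) \<le> R"
proof -
  define E where "E = infeas X"
  define \<Lambda> where "\<Lambda> = multiplier f X"
  define P where "P = transpose (plam_dir f \<beta> X) ** plam_dir f \<beta> X"
  let ?e = "norm E" and ?\<delta> = "\<beta> * s - M * N"
  have e: "0 \<le> ?e" "?e \<le> R" using R by (auto simp: E_def)
  have MN: "0 \<le> M * N"
    using norm_multiplier_le[OF M N] norm_ge_zero[of "multiplier f X"] by linarith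
  have "transpose X ** (X ** E) = E + E ** E"
    by (simp add: E_def matrix_mul_assoc gram_eq_infeas matrix_mult_bilinear_simps)
  moreover have "sym_part (E + E ** E) = E + E ** E"
    by (rule sym_part_eq) (simp add: E_def transpose_linear_simps matrix_transpose_mul transpose_infeas)
  ultimately have S: "sym_part (transpose X ** plam_dir f \<beta> X) = \<beta> *\<^sub>R (E + E ** E) - sym_part (E ** \<Lambda>)"
    using sym_part_transpose_mult_tangent[of X f]
    by (simp add: plam_dir_def matrix_mult_bilinear_simps sym_part_add sym_part_diff sym_part_scaleR
        E_def \<Lambda>_def)
  have "infeas (X - t *\<^sub>R plam_dir f \<beta> X)
      = (1 - 2 * t * \<beta>) *\<^sub>R E + (- (2 * t * \<beta>)) *\<^sub>R (E ** E) + (2 * t) *\<^sub>R sym_part (E ** \<Lambda>) + t\<^sup>2 *\<^sub>R P"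
    unfolding infeas_step S by (simp add: E_def[symmetric] P_def algebra_simps)
  also have "norm \<dots> \<le> norm ((1 - 2 * t * \<beta>) *\<^sub>R E) + norm ((- (2 * t * \<beta>)) *\<^sub>R (E ** E))
      + norm ((2 * t) *\<^sub>R sym_part (E ** \<Lambda>)) + norm (t\<^sup>2 *\<^sub>R P)"
    by (intro order_trans[OF norm_triangle_ineq] add_mono order_refl)
  also have "\<dots> \<le> (1 - 2 * t * \<beta>) * ?e + 2 * t * \<beta> * (?e * ?e) + 2 * t * (M * N * ?e) + t\<^sup>2 * B\<^sup>2"
  proof (intro add_mono)
    show "norm ((1 - 2 * t * \<beta>) *\<^sub>R E) \<le> (1 - 2 * t * \<beta>) * ?e" using t by simp
    have "norm ((- (2 * t * \<beta>)) *\<^sub>R (E ** E)) = 2 * t * \<beta> * norm (E ** E)"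
      using t \<beta> by (simp add: abs_mult)
    also have "\<dots> \<le> 2 * t * \<beta> * (?e * ?e)"
      using t \<beta> by (intro mult_left_mono norm_matrix_mult_le) simp
    finally show "norm ((- (2 * t * \<beta>)) *\<^sub>R (E ** E)) \<le> 2 * t * \<beta> * (?e * ?e)" .
    have "norm ((2 * t) *\<^sub>R sym_part (E ** \<Lambda>)) = 2 * t * norm (sym_part (E ** \<Lambda>))"
      using t by simp
    also have "\<dots> \<le> 2 * t * (M * N * ?e)"
      unfolding E_def \<Lambda>_def using t
      by (intro mult_left_mono order_trans[OF norm_sym_part_le norm_infeas_multiplier_le] M N) simp
    finally show "norm ((2 * t) *\<^sub>R sym_part (E ** \<Lambda>)) \<le> 2 * t * (M * N * ?e)" .
    have "norm P \<le> norm (plam_dir f \<beta> X) * norm (plam_dir f \<beta> X)"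
      unfolding P_def using norm_matrix_mult_le[of "transpose (plam_dir f \<beta> X)" "plam_dir f \<beta> X"]
      by (simp only: norm_transpose)
    also have "\<dots> \<le> B\<^sup>2"
      using D by (simp add: power2_eq_square mult_mono')
    finally show "norm (t\<^sup>2 *\<^sub>R P) \<le> t\<^sup>2 * B\<^sup>2" by (simp add: mult_left_mono)
  qed
  also have "\<dots> \<le> (1 - 2 * t * ?\<delta>) * ?e + t * (R * ?\<delta>)"
  proof -
    have "2 * t * \<beta> * (?e * s) \<le> 2 * t * \<beta> * (?e * (1 - ?e))"
      using e s t \<beta> by (intro mult_left_mono) auto
    moreover have "t\<^sup>2 * B\<^sup>2 \<le> t * (R * ?\<delta>)"
      using mult_left_mono[OF t(3) t(1)] by (simp add: power2_eq_square mult_ac)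
    ultimately show ?thesis by (simp add: algebra_simps)
  qed
  also have "\<dots> \<le> (1 - 2 * t * ?\<delta>) * R + t * (R * ?\<delta>)"
  proof -
    \<comment> \<open>Here \<open>s\<close> is at most 1, because \<open>R\<close> is nonnegative.
      The contraction factor is thus nonnegative, which permits replacing \<open>?e\<close> by
      \<open>R\<close>.\<close>
    have "2 * t * ?\<delta> \<le> 2 * t * \<beta>"
    proof -
      have "?\<delta> \<le> \<beta> * 1"
        using MN s e \<beta> mult_left_mono[of s 1 \<beta>] by linarith
      then show ?thesis using t by (simp add: mult_left_mono)
    qed
    then have "0 \<le> 1 - 2 * t * ?\<delta>" using t by linarith
    then show ?thesis using e by (intro add_right_mono mult_left_mono)
  qed
  also have "\<dots> = R - t * ?\<delta> * R" by (simp add: algebra_simps)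
  also have "\<dots> \<le> R"
  proof -
    have "0 \<le> R" using e by linarith
    then have "0 \<le> t * ?\<delta> * R" using t \<beta> by (intro mult_nonneg_nonneg) auto
    then show ?thesis by simp
  qed
  finally show ?thesis .
qed

section \<open>Decrease of the potential\<close>

text \<open>Here \<open>t\<close> is the actual step length and \<open>s = 1 / \<eta>_up\<close> a lower bound for it. The factor
  \<open>3/8\<close> is the best one for which the bound, linear in \<open>L * t\<close>, holds on all of \<open>[0, 2 c]\<close>.\<close>

lemma decrease_constant_le:
  fixes c L s t :: real
  assumes "0 \<le> s" "s \<le> t" "0 \<le> L" "L * t \<le> 2 * c"
  shows "c * s - L * s\<^sup>2 / 2 \<le> t * (c - 3/8 * (L * t))"
proof -
  have "t * (c - 3/8 * (L * t)) - (c * s - L * s\<^sup>2 / 2)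
      = (2 * c - L * t) / 2 * (t - s) + L * (t - 2 * s)\<^sup>2 / 8"
    by (simp add: power2_eq_square field_simps)
  also have "\<dots> \<ge> 0" using assms by simp
  finally show ?thesis by simp
qed

text \<open>Here \<open>d\<close> stands for the norm of the direction, \<open>y\<close> for its
  normal component and \<open>\<tau>\<close> for the Lipschitz constant times the step length. The
  two brackets are the decreases, per unit step length, of the merit function and of the penalty.
  The first is weakest at \<open>y = d\<close>, where the second is positive. Completing the square
  in \<open>y\<close> at 9/10 of \<open>d\<close> leaves the positive remainder that makes the
  inequality strict.\<close>

lemma combined_decrease:
  fixes c \<tau> y d :: real
  assumes c: "0 < c" "c < 1/2" and \<tau>: "\<tau> \<le> 2 * c" and y: "0 \<le> y" "y \<le> d" and d: "0 < d"
  shows "(c - 3/8 * \<tau>) * d\<^sup>2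
    < (1 - c/2) * ((1 - \<tau>/2) * d\<^sup>2 - (1 - c) * y * d) + c/2 * (5/6 * y\<^sup>2 - d\<^sup>2/4)"
proof -
  have "(1 - c/2) * ((1 - \<tau>/2) * d\<^sup>2 - (1 - c) * y * d) + c/2 * (5/6 * y\<^sup>2 - d\<^sup>2/4) - (c - 3/8 * \<tau>) * d\<^sup>2
    = (2 * c - \<tau>) * (1/8 - c/4) * d\<^sup>2 + ((1 - c/2) * (1 - c) - 3/4 * c) * ((d - y) * d)
      + c * (5/12 * (y - 9/10 * d)\<^sup>2 + 3/80 * d\<^sup>2)"
    by (simp add: power2_eq_square field_simps)
  moreover have "(1 - c/2) * (1 - c) - 3/4 * c \<ge> 0"
  proof -
    \<comment> \<open>Since c < 1/2, both c \<le> 1 - c and 3/4 \<le> 1 - c/2 hold.\<close>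
    have "3/4 * c \<le> 3/4 * (1 - c)" using c by simp
    also have "\<dots> \<le> (1 - c/2) * (1 - c)" using c by (intro mult_right_mono) auto
    finally show ?thesis by simp
  qed
  then have "0 \<le> ((1 - c/2) * (1 - c) - 3/4 * c) * ((d - y) * d)"
    using y by (intro mult_nonneg_nonneg) auto
  moreover have "0 \<le> (2 * c - \<tau>) * (1/8 - c/4) * d\<^sup>2"
    using c \<tau> by (intro mult_nonneg_nonneg) auto
  moreover have "0 < c * (5/12 * (y - 9/10 * d)\<^sup>2 + 3/80 * d\<^sup>2)"
    using c d by (intro mult_pos_pos add_nonneg_pos) auto
  ultimately show ?thesis by linarith
qed

text \<open>The quantity \<open>q\<close> is the squared normal part with the cross term counted in,
  so that it never exceeds the squared norm of the direction. The hypothesis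
  \<open>4 * (M * N) \<le> \<beta> * s\<close> bounds \<beta> times the tangent-normal inner product
  by a quarter of the squared normal part, and 5/6 is the factor this ratio permits.\<close>

lemma normal_component_bounds:
  fixes f :: "real^'p^'n \<Rightarrow> real" and X :: "real^'p^'n" and \<beta> :: real
  defines "q \<equiv> (norm (plam_dir f \<beta> X))\<^sup>2 - (norm (grad f X - X ** multiplier f X))\<^sup>2"
  assumes M: "spectral_norm X \<le> M" and N: "norm (grad f X) \<le> N"
    and s: "norm (infeas X) \<le> 1 - s" and \<beta>: "0 \<le> \<beta>" "4 * (M * N) \<le> \<beta> * s"
  shows "(\<beta>\<^sup>2 * s - 2 * \<beta> * (M * N)) * (norm (infeas X))\<^sup>2 \<le> q"
    and "5/6 * q \<le> \<beta> * ((X ** infeas X) \<bullet> plam_dir f \<beta> X)"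
proof -
  define T where "T = grad f X - X ** multiplier f X"
  define Y where "Y = X ** infeas X"
  let ?e = "norm (infeas X)"
  have D: "plam_dir f \<beta> X = T + \<beta> *\<^sub>R Y" by (simp add: plam_dir_def T_def Y_def)
  have q: "q = \<beta>\<^sup>2 * (norm Y)\<^sup>2 + 2 * (\<beta> * (T \<bullet> Y))"
    unfolding q_def D T_def[symmetric] power2_norm_eq_inner
    by (simp add: inner_add_left inner_add_right inner_commute power2_eq_square)
  have YD: "\<beta> * (Y \<bullet> plam_dir f \<beta> X) = \<beta>\<^sup>2 * (norm Y)\<^sup>2 + \<beta> * (T \<bullet> Y)"
    unfolding D power2_norm_eq_inner
    by (simp add: inner_add_right inner_commute power2_eq_square algebra_simps)
  have "\<bar>T \<bullet> Y\<bar> \<le> M * N * ?e\<^sup>2"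
    unfolding T_def Y_def by (rule inner_tangent_normal_le[OF M N])
  then have w: "\<bar>\<beta> * (T \<bullet> Y)\<bar> \<le> \<beta> * (M * N * ?e\<^sup>2)"
    using \<beta> by (simp add: abs_mult mult_left_mono)
  have "s * ?e\<^sup>2 \<le> (1 - ?e) * ?e\<^sup>2"
    using s by (intro mult_right_mono) auto
  also have "\<dots> \<le> (norm Y)\<^sup>2" unfolding Y_def by (rule norm_matrix_mult_infeas_ge)
  finally have Y: "\<beta>\<^sup>2 * (s * ?e\<^sup>2) \<le> \<beta>\<^sup>2 * (norm Y)\<^sup>2" by (intro mult_left_mono) auto
  have "\<beta> * (4 * (M * N) * ?e\<^sup>2) \<le> \<beta> * (\<beta> * s * ?e\<^sup>2)"
    using \<beta> by (intro mult_left_mono mult_right_mono) auto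
  then have w4: "4 * (\<beta> * (M * N * ?e\<^sup>2)) \<le> \<beta>\<^sup>2 * (s * ?e\<^sup>2)"
    by (simp add: power2_eq_square mult_ac)
  have split: "(\<beta>\<^sup>2 * s - 2 * \<beta> * (M * N)) * ?e\<^sup>2 = \<beta>\<^sup>2 * (s * ?e\<^sup>2) - 2 * (\<beta> * (M * N * ?e\<^sup>2))"
    by (simp add: algebra_simps)
  show "(\<beta>\<^sup>2 * s - 2 * \<beta> * (M * N)) * ?e\<^sup>2 \<le> q"
    unfolding split q using w Y by linarith
  show "5/6 * q \<le> \<beta> * ((X ** infeas X) \<bullet> plam_dir f \<beta> X)"
    unfolding Y_def[symmetric] YD q using w Y w4 by (simp add: field_simps)
qed

text \<open>A step with \<open>\<eta>\<close> close to \<open>L\<^sub>h / (2 c)\<close> may decrease the merit function by less than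
  \<open>c\<^sub>3\<close> times the squared norm of the direction, because \<open>c / \<eta> - L\<^sub>h / (2 \<eta>\<^sup>2)\<close> vanishes
  there while \<open>c\<^sub>3\<close> only sees the upper bound of \<open>\<eta>\<close>. Mixing in a little of the pure feasibility
  measure repairs this, since the estimate for the merit function is only tight when the normal
  component dominates; a convex combination keeps the initial gap within the same bound.\<close>

definition plam_potential :: "real \<Rightarrow> (real^'p^'n \<Rightarrow> real) \<Rightarrow> real \<Rightarrow> real^'p^'n \<Rightarrow> real" where
  "plam_potential c f \<beta> X =
     (1 - c/2) * merit f \<beta> X + c/2 * (\<beta>/4 * (norm (infeas X))\<^sup>2)"

text \<open>The merit function is estimated by descent along the segment, the penalty by the
  midpoint expansion. Both bounds are expressed through \<open>d\<close> and \<open>y\<close>, and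
  \<open>combined_decrease\<close> adds them with the weights of the potential.\<close>

lemma plam_potential_decrease:
  fixes f :: "real^'p^'n \<Rightarrow> real" and X :: "real^'p^'n" and \<beta> :: real
  defines "D \<equiv> plam_dir f \<beta> X"
  assumes f: "twice_cont_diff f"
    and M: "\<And>Y :: real^'p^'n. norm (infeas Y) \<le> R \<Longrightarrow> spectral_norm Y \<le> M"
    and N: "norm (grad f X) \<le> N" and L: "norm (hess f X) \<le> L"
    and seg: "\<And>u. 0 \<le> u \<Longrightarrow> u \<le> t \<Longrightarrow> norm (infeas (X - u *\<^sub>R D)) \<le> R"
    and lip: "\<And>Y Z. norm (infeas Y) \<le> R \<Longrightarrow> norm (infeas Z) \<le> R \<Longrightarrow>
           norm (grad (merit f \<beta>) Y - grad (merit f \<beta>) Z) \<le> K * norm (Y - Z)"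
    and s: "R \<le> 1 - s" and \<beta>: "0 \<le> \<beta>" "4 * (M * N) \<le> \<beta> * s"
    and c: "0 < c" "c < 1/2"
    and curv: "(N + L * M)\<^sup>2 \<le> 4 * (1 - 2 * c) * (\<beta>\<^sup>2 * s - 2 * \<beta> * (M * N))"
    and t: "0 < t" "2 * t * \<beta> * (R + 2 * M\<^sup>2) \<le> 1" "K * t \<le> 2 * c"
    and D: "D \<noteq> 0"
  shows "plam_potential c f \<beta> (X - t *\<^sub>R D)
    < plam_potential c f \<beta> X - t * (c - 3/8 * (K * t)) * (norm D)\<^sup>2"
proof -
  define e where "e = norm (infeas X)"
  define e' where "e' = norm (infeas (X - t *\<^sub>R D))"
  define d where "d = norm D"
  define q where "q = d\<^sup>2 - (norm (grad f X - X ** multiplier f X))\<^sup>2"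
  define y where "y = sqrt q"
  have X: "norm (infeas X) \<le> R" using seg[of 0] t by simp
  have normal: "(\<beta>\<^sup>2 * s - 2 * \<beta> * (M * N)) * e\<^sup>2 \<le> q"
    "5/6 * q \<le> \<beta> * ((X ** infeas X) \<bullet> D)"
    unfolding q_def d_def D_def e_def
    using normal_component_bounds[OF M[OF X] N order_trans[OF X s] \<beta>] by auto
  have "0 \<le> 4 * (1 - 2 * c) * (\<beta>\<^sup>2 * s - 2 * \<beta> * (M * N))"
    by (rule order_trans[OF zero_le_power2 curv])
  then have "0 \<le> \<beta>\<^sup>2 * s - 2 * \<beta> * (M * N)"
    using c mult_le_cancel_left_pos[of "4 * (1 - 2 * c)" 0] by simp
  then have q0: "0 \<le> q"
    by (intro order_trans[OF _ normal(1)] mult_nonneg_nonneg) auto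
  have y: "0 \<le> y" "y \<le> d" "y\<^sup>2 = q"
    using q0 by (auto simp: y_def q_def d_def intro!: real_le_lsqrt)
  \<comment> \<open>This is where a large \<open>\<beta>\<close> pays off: the error in the gradient
    of the merit function is dominated by the normal component. Weakening 1 - 2 c to (1 - c)^2 gives
    a bound free of square roots in \<open>c\<close>.\<close>
  have curve: "(N + L * M) / 2 * e \<le> (1 - c) * y"
  proof (rule power2_le_imp_le)
    have "((N + L * M) / 2 * e)\<^sup>2 = (N + L * M)\<^sup>2 * e\<^sup>2 / 4"
      by (simp add: power_mult_distrib power_divide)
    also have "\<dots> \<le> 4 * (1 - 2 * c) * (\<beta>\<^sup>2 * s - 2 * \<beta> * (M * N)) * e\<^sup>2 / 4"
      by (intro divide_right_mono mult_right_mono curv) auto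
    also have "\<dots> = (1 - 2 * c) * ((\<beta>\<^sup>2 * s - 2 * \<beta> * (M * N)) * e\<^sup>2)" by simp
    also have "\<dots> \<le> (1 - 2 * c) * q" using c by (intro mult_left_mono normal) auto
    also have "\<dots> \<le> (1 - c)\<^sup>2 * q"
      using q0 by (intro mult_right_mono) (auto simp: power2_eq_square algebra_simps)
    finally show "((N + L * M) / 2 * e)\<^sup>2 \<le> ((1 - c) * y)\<^sup>2"
      by (simp add: power_mult_distrib y)
  qed (use y c in simp)
  have "merit f \<beta> (X - t *\<^sub>R D) \<le> merit f \<beta> X - t * (grad (merit f \<beta>) X \<bullet> D) + K / 2 * t\<^sup>2 * d\<^sup>2"
    unfolding d_def
  proof (rule descent_along_segment)
    show "merit f \<beta> differentiable (at (X - u *\<^sub>R D))" for u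
      using merit_has_derivative[OF f] by (auto simp: differentiable_def)
    show "norm (grad (merit f \<beta>) (X - u *\<^sub>R D) - grad (merit f \<beta>) X) \<le> K * (u * norm D)"
      if "0 \<le> u" "u \<le> t" for u
      using lip[OF seg[OF that] X] that by simp
  qed (use t in simp)
  also have "\<dots> \<le> merit f \<beta> X - t * (d\<^sup>2 - (1 - c) * y * d) + K / 2 * t\<^sup>2 * d\<^sup>2"
  proof -
    have "d\<^sup>2 - (N + L * M) / 2 * e * d \<le> grad (merit f \<beta>) X \<bullet> D"
      unfolding d_def e_def
      by (rule inner_grad_merit_ge[OF f M[OF X] N L]) (simp add: D_def plam_dir_def)
    moreover have "(N + L * M) / 2 * e * d \<le> (1 - c) * y * d"
      by (intro mult_right_mono curve) (simp add: d_def)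
    ultimately have "t * (d\<^sup>2 - (1 - c) * y * d) \<le> t * (grad (merit f \<beta>) X \<bullet> D)"
      using t by (intro mult_left_mono) auto
    then show ?thesis by linarith
  qed
  finally have h: "merit f \<beta> (X - t *\<^sub>R D)
      \<le> merit f \<beta> X - t * ((1 - K * t / 2) * d\<^sup>2 - (1 - c) * y * d)"
    by (simp add: power2_eq_square algebra_simps)
  \<comment> \<open>The spectral bound is needed at the midpoint of the step, hence the instance
    \<open>t/2\<close> of \<open>seg\<close>.\<close>
  have "e'\<^sup>2 \<le> e\<^sup>2 - 4 * t * ((X ** infeas X) \<bullet> D) + 2 * t\<^sup>2 * (R + 2 * M\<^sup>2) * d\<^sup>2"
    unfolding e'_def e_def d_def using seg[of "t/2"] t X
    by (intro norm_infeas_sq_step_le M) auto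
  then have "\<beta>/4 * e'\<^sup>2 \<le> \<beta>/4 * (e\<^sup>2 - 4 * t * ((X ** infeas X) \<bullet> D) + 2 * t\<^sup>2 * (R + 2 * M\<^sup>2) * d\<^sup>2)"
    using \<beta> by (intro mult_left_mono) auto
  also have "\<dots> = \<beta>/4 * e\<^sup>2 - t * (\<beta> * ((X ** infeas X) \<bullet> D))
      + t * d\<^sup>2 / 4 * (2 * t * \<beta> * (R + 2 * M\<^sup>2))"
    by (simp add: power2_eq_square algebra_simps)
  also have "\<dots> \<le> \<beta>/4 * e\<^sup>2 - t * (5/6 * q) + t * d\<^sup>2 / 4 * 1"
    using t normal(2) by (intro add_mono diff_mono mult_left_mono order_refl) auto
  finally have g: "\<beta>/4 * e'\<^sup>2 \<le> \<beta>/4 * e\<^sup>2 - t * (5/6 * y\<^sup>2 - d\<^sup>2/4)"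
    by (simp add: y algebra_simps)
  have "plam_potential c f \<beta> (X - t *\<^sub>R D)
    \<le> (1 - c/2) * (merit f \<beta> X - t * ((1 - K * t / 2) * d\<^sup>2 - (1 - c) * y * d))
      + c/2 * (\<beta>/4 * e\<^sup>2 - t * (5/6 * y\<^sup>2 - d\<^sup>2/4))"
    unfolding plam_potential_def e'_def[symmetric]
    using c by (intro add_mono mult_left_mono h g) auto
  also have "\<dots> = plam_potential c f \<beta> X
      - t * ((1 - c/2) * ((1 - K * t / 2) * d\<^sup>2 - (1 - c) * y * d) + c/2 * (5/6 * y\<^sup>2 - d\<^sup>2/4))"
    by (simp add: plam_potential_def e_def algebra_simps)
  also have "\<dots> < plam_potential c f \<beta> X - t * ((c - 3/8 * (K * t)) * d\<^sup>2)"
    using D by (intro diff_strict_left_mono mult_strict_left_mono combined_decrease c t y)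
      (simp add: d_def)
  finally show ?thesis by (simp add: d_def)
qed

lemma plam_potential_diff_le:
  assumes c: "0 \<le> c" "c \<le> 2" and \<beta>: "0 \<le> \<beta>" and b: "0 \<le> b"
    and X: "norm (infeas X) \<le> R" "\<bar>multiplier f X \<bullet> infeas X\<bar> \<le> b * norm (infeas X)"
    and Y: "norm (infeas Y) \<le> R" "\<bar>multiplier f Y \<bullet> infeas Y\<bar> \<le> b * norm (infeas Y)"
    and low: "m \<le> f X" "m \<le> f Y"
  shows "plam_potential c f \<beta> X - plam_potential c f \<beta> Y \<le> f X - m + b * R + \<beta> * R\<^sup>2 / 4"
proof -
  let ?x = "norm (infeas X)" and ?y = "norm (infeas Y)"
  let ?A = "f X - f Y - 1/2 * (multiplier f X \<bullet> infeas X) + 1/2 * (multiplier f Y \<bullet> infeas Y)"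
  have "b * ?x \<le> b * R" "b * ?y \<le> b * R" using X Y b by (auto intro: mult_left_mono)
  then have A: "?A \<le> f X - m + b * R" and A0: "0 \<le> f X - m + b * R"
    using X(2) Y(2) low mult_nonneg_nonneg[OF b, of ?x] by auto
  have "(1 - c/2) * ?A \<le> (1 - c/2) * (f X - m + b * R)"
    using A c by (intro mult_left_mono) auto
  also have "\<dots> \<le> 1 * (f X - m + b * R)"
    using A0 c by (intro mult_right_mono) auto
  finally have "(1 - c/2) * ?A \<le> f X - m + b * R" by simp
  moreover have "\<beta>/4 * (?x\<^sup>2 - ?y\<^sup>2) \<le> \<beta>/4 * R\<^sup>2"
  proof (rule mult_left_mono)
    have "?x\<^sup>2 \<le> R\<^sup>2" using X by (intro power_mono) auto
    then show "?x\<^sup>2 - ?y\<^sup>2 \<le> R\<^sup>2" using zero_le_power2[of ?y] by linarith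
  qed (use \<beta> in simp)
  moreover have "plam_potential c f \<beta> X - plam_potential c f \<beta> Y = (1 - c/2) * ?A + \<beta>/4 * (?x\<^sup>2 - ?y\<^sup>2)"
    by (simp add: plam_potential_def merit_def multiplier_def field_simps)
  ultimately show ?thesis by simp
qed

section \<open>Vanishing directions and stationarity\<close>

lemma grad_aug_lagrangian_eq_plam_dir:
  assumes "twice_cont_diff f"
  shows "grad_aug_lagrangian f \<beta> X (multiplier f X) = plam_dir f \<beta> X"
  using assms
  by (simp add: plam_dir_def grad_aug_lagrangian_eq multiplier_def transpose_sym_part
      twice_cont_diff_def)

lemma continuous_on_plam_dir:
  assumes "twice_cont_diff f"
  shows "continuous_on A (plam_dir f \<beta>)"
  unfolding plam_dir_def[abs_def] multiplier_def sym_part_def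
  by (intro continuous_intros continuous_on_matrix_mult continuous_on_transpose
      continuous_on_infeas twice_cont_diff_continuous_grad assms)

text \<open>Feasibility removes the penalty, so the gradient is \<open>X ** multiplier f X\<close>.
  Multiplying by \<open>transpose X\<close> and using the symmetry of the multiplier identifies
  \<open>transpose (grad f X) ** X\<close> with it.\<close>

lemma first_order_stationaryI:
  assumes E: "infeas X = 0" and D: "plam_dir f \<beta> X = 0"
  shows "first_order_stationary f X"
proof -
  have XX: "transpose X ** X = mat 1" using E by (simp add: infeas_def)
  have G: "grad f X = X ** multiplier f X"
    using D E by (simp add: plam_dir_def bounded_bilinear.zero_right[OF bounded_bilinear_matrix_mult])
  then have "transpose (grad f X) ** X = transpose (transpose X ** (X ** multiplier f X))"
    by (metis matrix_transpose_mul transpose_transpose)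
  also have "\<dots> = multiplier f X"
    by (simp add: matrix_mul_assoc XX multiplier_def transpose_sym_part)
  finally have "X ** transpose (grad f X) ** X = X ** multiplier f X"
    by (simp flip: matrix_mul_assoc)
  with G XX show ?thesis by (simp add: first_order_stationary_def)
qed

lemma tendsto_zero_of_sum_norm_sq_bounded:
  fixes d :: "nat \<Rightarrow> 'a::real_normed_vector"
  assumes c: "0 < c" and B: "\<And>K. (\<Sum>k<K. c * (norm (d k))\<^sup>2) \<le> B"
  shows "d \<longlonglongrightarrow> 0"
proof -
  have "(\<Sum>k\<le>n. c * (norm (d k))\<^sup>2) \<le> B" for n
    using B[of "Suc n"] by (simp only: lessThan_Suc_atMost)
  then have "summable (\<lambda>k. c * (norm (d k))\<^sup>2)"
    using c by (intro bounded_imp_summable[where B = B]) auto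
  then have "(\<lambda>k. c * (norm (d k))\<^sup>2) \<longlonglongrightarrow> 0" by (rule summable_LIMSEQ_zero)
  then have "(\<lambda>k. 1/c * (c * (norm (d k))\<^sup>2)) \<longlonglongrightarrow> 1/c * 0" by (intro tendsto_intros)
  then have "(\<lambda>k. (norm (d k))\<^sup>2) \<longlonglongrightarrow> 0" using c by simp
  then have "(\<lambda>k. sqrt ((norm (d k))\<^sup>2)) \<longlonglongrightarrow> sqrt 0" by (rule tendsto_real_sqrt)
  then show ?thesis by (simp add: tendsto_norm_zero_iff)
qed

section \<open>Convergence and rate of the iteration\<close>

theorem theorem4p7:
  fixes f :: "real^'p^'n \<Rightarrow> real"
    and X0 :: "real^'p^'n"
    and X :: "nat \<Rightarrow> real^'p^'n"
    and \<C> :: "(real^'p^'n) set"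
    and \<eta> :: "nat \<Rightarrow> real"
    and \<sigma> \<beta> c1 c2 c3 R M N L N\<^sub>L L\<^sub>h f_low \<eta>_low \<eta>_up :: real
  assumes dims: "2 * CARD('p) \<le> CARD('n)"
    and f_C2: "twice_cont_diff f"
    and \<sigma>_range: "0 < \<sigma>" "\<sigma> < 1"
    and X0_qualified: "qualified_initial_guess \<sigma> X0"
    and R_def: "R = norm (transpose X0 ** X0 - mat 1)"
    and \<C>_def: "\<C> = {Y. norm (transpose Y ** Y - mat 1) \<le> R}"
    and f_low_def: "f_low = (INF Y\<in>\<C>. f Y)"
    and M_def: "M = (SUP Y\<in>\<C>. spectral_norm Y)"
    and N_def: "N = (SUP Y\<in>\<C>. norm (grad f Y))"
    and L_def: "L = (SUP Y\<in>\<C>. norm (hess f Y))"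
    and c1_range: "0 < c1" "c1 < 1/2"
    and \<beta>_large: "\<beta> > Max {M * N / \<sigma>\<^sup>2
                   + sqrt (M\<^sup>2 * N\<^sup>2 / \<sigma>^4 + (N + L * M)\<^sup>2 / (4 * \<sigma>\<^sup>2 * (1 - 2 * c1))),
                 M * N / \<sigma>,
                 4 * M * N / \<sigma>\<^sup>2}"
    and L\<^sub>h_pos: "0 < L\<^sub>h"
    and L\<^sub>h_Lipschitz: "\<And>Y Z. Y \<in> \<C> \<Longrightarrow> Z \<in> \<C> \<Longrightarrow>
           norm (grad (merit f \<beta>) Y - grad (merit f \<beta>) Z) \<le> L\<^sub>h * norm (Y - Z)"
    and N\<^sub>L_def: "N\<^sub>L = (1 + M\<^sup>2) * N + \<beta> * R * M"
    and c2_range: "0 < c2" "c2 \<le> R\<^sup>2 * (\<beta> * \<sigma>\<^sup>2 - 4 * M * N) / (2 * N\<^sub>L\<^sup>2)"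
    and \<eta>_low_def: "\<eta>_low = Max {L\<^sub>h / (2 * c1),
                 (2 * N\<^sub>L * M + N\<^sub>L * sqrt (4 * M\<^sup>2 + 2 * R)) / R,
                 (R + 2 * M\<^sup>2) / c2}"
    and \<eta>_up_ge: "\<eta>_low \<le> \<eta>_up"
    and \<eta>_range: "\<And>k. \<eta>_low \<le> \<eta> k \<and> \<eta> k \<le> \<eta>_up"
    and c3_def: "c3 = c1 / \<eta>_up - L\<^sub>h / (2 * \<eta>_up\<^sup>2)"
    and c3_pos: "0 < c3"
    and X_init: "X 0 = X0"
    and X_plam: "plam_sequence f \<beta> \<eta> X"
  shows "(\<exists>l. cluster_point X l) \<and>
         (\<forall>l. cluster_point X l \<longrightarrow> first_order_stationary f l) \<and>
         (\<forall>K::nat. K > 1 \<longrightarrow>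
            Min ((\<lambda>k. norm (grad_aug_lagrangian f \<beta> (X k) (multiplier f (X k)))) ` {0..K - 1})
              < sqrt ((f X0 - f_low + M * N * R + \<beta> * R\<^sup>2 / 4) / (c3 * real K)))"
proof -
  let ?s = "\<sigma>\<^sup>2" and ?\<mu> = "M * N"
  let ?d = "\<lambda>k. plam_dir f \<beta> (X k)" and ?\<Phi> = "plam_potential c1 f \<beta>"
  have C: "Y \<in> \<C> \<longleftrightarrow> norm (infeas Y) \<le> R" for Y
    by (simp add: \<C>_def infeas_def)
  have X0C: "X0 \<in> \<C>" and R: "0 < R" "R \<le> 1 - ?s"
    using X0_qualified by (auto simp: C R_def qualified_initial_guess_def infeas_def)
  have compact: "compact \<C>"
    using compact_infeas_le[of R] by (simp add: \<C>_def infeas_def)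
  \<comment> \<open>A real \<open>SUP\<close> or \<open>INF\<close> bounds its family only when that
    family is bounded; compactness of \<open>\<C>\<close> provides this.\<close>
  have bdd: "bdd_above (g ` \<C>)" "bdd_below (g ` \<C>)"
    if "continuous_on \<C> g" for g :: "real^'p^'n \<Rightarrow> real"
    using compact_imp_bounded[OF compact_continuous_image[OF that compact]]
    by (auto intro: bounded_imp_bdd_above bounded_imp_bdd_below)
  \<comment> \<open>Comparison with the Frobenius norm gives boundedness without proving the
    spectral norm continuous.\<close>
  have M_ge: "spectral_norm Y \<le> M" if "Y \<in> \<C>" for Y
  proof -
    obtain b where "\<And>Y. Y \<in> \<C> \<Longrightarrow> norm Y \<le> b"
      using compact_imp_bounded[OF compact] by (auto simp: bounded_iff)
    then have "bdd_above (spectral_norm ` \<C>)"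
      by (auto intro!: bdd_aboveI2 order_trans[OF spectral_norm_le_norm])
    then show ?thesis unfolding M_def using that by (rule cSUP_upper[rotated])
  qed
  have N_ge: "norm (grad f Y) \<le> N" if "Y \<in> \<C>" for Y
    unfolding N_def using that
    by (intro cSUP_upper bdd continuous_intros twice_cont_diff_continuous_grad f_C2)
  have L_ge: "norm (hess f Y) \<le> L" if "Y \<in> \<C>" for Y
    unfolding L_def using that f_C2 unfolding twice_cont_diff_def
    by (intro cSUP_upper bdd continuous_intros) (auto intro: continuous_on_subset)
  have f_ge: "f_low \<le> f Y" if "Y \<in> \<C>" for Y
  proof -
    have "continuous_on \<C> f"
      using f_C2 by (auto simp: twice_cont_diff_def intro!: differentiable_imp_continuous_on
          differentiable_at_imp_differentiable_on)
    then show ?thesis unfolding f_low_def using that by (intro cINF_lower bdd)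
  qed
  note mult_bound = norm_inner_multiplier_infeas_le[OF M_ge N_ge]

  have M0: "0 \<le> M" using M_ge[OF X0C] spectral_norm_nonneg[of X0] by linarith
  have N0: "0 \<le> N" using N_ge[OF X0C] norm_ge_zero[of "grad f X0"] by linarith
  have \<mu>0: "0 \<le> ?\<mu>" using M0 N0 by simp
  have s: "0 < ?s" using \<sigma>_range by simp
  have M_sq: "1 - R \<le> M\<^sup>2"
  proof -
    have "1 - R \<le> (spectral_norm X0)\<^sup>2"
      using one_minus_norm_infeas_le_spectral_norm[of X0] by (simp add: R_def infeas_def)
    also have "\<dots> \<le> M\<^sup>2" by (intro power_mono M_ge X0C spectral_norm_nonneg)
    finally show ?thesis .
  qed
  have RM: "1 \<le> R + 2 * M\<^sup>2" "R \<le> R + 2 * M\<^sup>2" using M_sq R s by linarith+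
  have M_pos: "0 < M"
  proof (rule ccontr)
    assume "\<not> 0 < M"
    then have "M = 0" using M0 by simp
    then show False using M_sq R s by simp
  qed

  \<comment> \<open>Consequences of the parameter assumption\<close>
  have \<beta>1: "?\<mu> / ?s + sqrt (M\<^sup>2 * N\<^sup>2 / \<sigma>^4 + (N + L * M)\<^sup>2 / (4 * ?s * (1 - 2 * c1))) < \<beta>"
    and \<beta>2: "?\<mu> / \<sigma> < \<beta>" and \<beta>3: "4 * M * N / ?s < \<beta>"
    using \<beta>_large by auto
  have \<beta>0: "0 < \<beta>"
    using \<beta>2 \<mu>0 \<sigma>_range by (meson divide_nonneg_pos le_less_trans)
  have \<beta>\<mu>: "4 * ?\<mu> < \<beta> * ?s" using \<beta>3 s by (simp add: pos_divide_less_eq mult.assoc)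
  \<comment> \<open>The first lower bound on \<open>\<beta>\<close> is the larger root of x^2 - 2 a
    x = q with a = \<open>?a\<close> and q = \<open>?q\<close>; completing the square recovers the
    quadratic inequality.\<close>
  have curv: "(N + L * M)\<^sup>2 \<le> 4 * (1 - 2 * c1) * (\<beta>\<^sup>2 * ?s - 2 * \<beta> * ?\<mu>)"
  proof -
    let ?a = "?\<mu> / ?s" and ?q = "(N + L * M)\<^sup>2 / (4 * ?s * (1 - 2 * c1))"
    have q: "0 \<le> ?q" using c1_range s by simp
    have a: "M\<^sup>2 * N\<^sup>2 / \<sigma>^4 = ?a\<^sup>2"
      by (simp add: power_divide power_mult_distrib flip: power_mult)
    have "?a\<^sup>2 + ?q = (sqrt (?a\<^sup>2 + ?q))\<^sup>2" using q by simp
    also have "\<dots> \<le> (\<beta> - ?a)\<^sup>2"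
      using \<beta>1 q unfolding a by (intro power_mono) auto
    finally have "?q \<le> \<beta>\<^sup>2 - 2 * \<beta> * ?a" by (simp add: power2_eq_square algebra_simps)
    then have "(N + L * M)\<^sup>2 \<le> (\<beta>\<^sup>2 - 2 * \<beta> * ?a) * (4 * ?s * (1 - 2 * c1))"
      using c1_range s by (subst (asm) pos_divide_le_eq) auto
    also have "\<dots> = 4 * (1 - 2 * c1) * (\<beta>\<^sup>2 * ?s - 2 * \<beta> * (?a * ?s))"
      by (simp add: algebra_simps)
    also have "?a * ?s = ?\<mu>" using s by simp
    finally show ?thesis .
  qed
  have NL: "\<beta> * R * M \<le> N\<^sub>L" "0 < N\<^sub>L"
  proof -
    have "0 < \<beta> * R * M" using \<beta>0 R M_pos by simp
    moreover have "0 \<le> (1 + M\<^sup>2) * N" using N0 by simp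
    ultimately show "\<beta> * R * M \<le> N\<^sub>L" "0 < N\<^sub>L" unfolding N\<^sub>L_def by linarith+
  qed

  have \<eta>_ge: "L\<^sub>h / (2 * c1) \<le> \<eta>_low" "(R + 2 * M\<^sup>2) / c2 \<le> \<eta>_low"
    unfolding \<eta>_low_def by (auto intro: Max_ge)
  have \<eta>_low_pos: "0 < \<eta>_low"
    using \<eta>_ge(1) L\<^sub>h_pos c1_range by (smt (verit) divide_pos_pos)
  \<comment> \<open>An upper bound for all step lengths; every smallness condition on a step is
    verified for it once.\<close>
  define \<tau> where "\<tau> = 1 / \<eta>_low"
  have \<tau>0: "0 < \<tau>" using \<eta>_low_pos by (simp add: \<tau>_def)
  have \<tau>L: "L\<^sub>h * \<tau> \<le> 2 * c1"
    using \<eta>_ge(1) c1_range \<eta>_low_pos by (simp add: \<tau>_def field_simps)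
  have \<tau>c: "\<tau> * (R + 2 * M\<^sup>2) \<le> c2"
    using \<eta>_ge(2) c2_range \<eta>_low_pos by (simp add: \<tau>_def field_simps)
  have \<tau>NL: "2 * \<tau> * (R + 2 * M\<^sup>2) * N\<^sub>L\<^sup>2 \<le> R\<^sup>2 * (\<beta> * ?s - 4 * ?\<mu>)"
  proof -
    have "\<tau> * (R + 2 * M\<^sup>2) \<le> R\<^sup>2 * (\<beta> * ?s - 4 * ?\<mu>) / (2 * N\<^sub>L\<^sup>2)"
      using \<tau>c c2_range by (simp add: mult.assoc)
    then show ?thesis using NL by (simp add: field_simps)
  qed
  \<comment> \<open>The limit on \<open>c2\<close> involves \<open>N\<^sub>L\<close>, which is at
    least \<open>\<beta> * R * M\<close>. Substituting this and bounding
    \<open>\<sigma>\<^sup>2\<close> by \<open>M\<^sup>2\<close> leaves the positive factor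
    \<open>R\<^sup>2 * (\<beta> * M\<^sup>2)\<close> on both sides.\<close>
  have \<tau>\<beta>: "2 * \<tau> * \<beta> * (R + 2 * M\<^sup>2) \<le> 1"
  proof -
    have "2 * \<tau> * (R + 2 * M\<^sup>2) * (\<beta> * R * M)\<^sup>2 \<le> 2 * \<tau> * (R + 2 * M\<^sup>2) * N\<^sub>L\<^sup>2"
      using \<tau>0 RM \<beta>0 R M0 NL by (intro mult_left_mono power_mono) auto
    also note \<tau>NL
    also have "R\<^sup>2 * (\<beta> * ?s - 4 * ?\<mu>) \<le> R\<^sup>2 * (\<beta> * M\<^sup>2)"
    proof (rule mult_left_mono)
      have "?s \<le> M\<^sup>2" using M_sq R by linarith
      then have "\<beta> * ?s \<le> \<beta> * M\<^sup>2" using \<beta>0 by simp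
      then show "\<beta> * ?s - 4 * ?\<mu> \<le> \<beta> * M\<^sup>2" using \<mu>0 by linarith
    qed simp
    finally have "(2 * \<tau> * \<beta> * (R + 2 * M\<^sup>2)) * (R\<^sup>2 * (\<beta> * M\<^sup>2)) \<le> 1 * (R\<^sup>2 * (\<beta> * M\<^sup>2))"
      by (simp add: power2_eq_square mult_ac)
    then show ?thesis using R \<beta>0 M_pos by (subst (asm) mult_le_cancel_right_pos) auto
  qed
  have \<tau>B: "\<tau> * N\<^sub>L\<^sup>2 \<le> R * (\<beta> * ?s - ?\<mu>)"
  proof -
    have "2 * \<tau> * R * N\<^sub>L\<^sup>2 \<le> 2 * \<tau> * (R + 2 * M\<^sup>2) * N\<^sub>L\<^sup>2"
      using \<tau>0 RM by (intro mult_left_mono mult_right_mono) auto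
    also note \<tau>NL
    also have "R\<^sup>2 * (\<beta> * ?s - 4 * ?\<mu>) \<le> R\<^sup>2 * (2 * (\<beta> * ?s - ?\<mu>))"
      using \<beta>\<mu> \<mu>0 by (intro mult_left_mono) auto
    finally have "(\<tau> * N\<^sub>L\<^sup>2) * (2 * R) \<le> (R * (\<beta> * ?s - ?\<mu>)) * (2 * R)"
      by (simp add: power2_eq_square mult_ac)
    then show ?thesis using R by (subst (asm) mult_le_cancel_right_pos) auto
  qed

  \<comment> \<open>All shorter steps are included, because the Lipschitz estimate is applied along
    the whole segment between iterates.\<close>
  have step_in_C: "Y - u *\<^sub>R plam_dir f \<beta> Y \<in> \<C>" if Y: "Y \<in> \<C>" and u: "0 \<le> u" "u \<le> \<tau>" for Y u
  proof -
    have "2 * u * \<beta> \<le> 2 * \<tau> * \<beta> * (R + 2 * M\<^sup>2)"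
      using mult_mono[of "2 * u * \<beta>" "2 * \<tau> * \<beta>" 1 "R + 2 * M\<^sup>2"] u \<beta>0 RM by simp
    with \<tau>\<beta> have "2 * u * \<beta> \<le> 1" by linarith
    moreover have "u * N\<^sub>L\<^sup>2 \<le> R * (\<beta> * ?s - ?\<mu>)"
      using \<tau>B mult_right_mono[OF u(2), of "N\<^sub>L\<^sup>2"] by simp
    moreover have "norm (plam_dir f \<beta> Y) \<le> N\<^sub>L"
      unfolding N\<^sub>L_def using Y \<beta>0 by (intro norm_plam_dir_le M_ge N_ge) (auto simp: C)
    ultimately show ?thesis
      unfolding C using Y R s u \<beta>0 \<beta>\<mu> \<mu>0
      by (intro plam_step_feasible[OF M_ge N_ge, where s = ?s and B = N\<^sub>L]) (auto simp: C)
  qed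
  have \<eta>k: "0 < 1 / \<eta> k" "1 / \<eta> k \<le> \<tau>" "1 / \<eta>_up \<le> 1 / \<eta> k" "0 \<le> 1 / \<eta>_up" for k
    using \<eta>_range[of k] \<eta>_low_pos by (auto simp: \<tau>_def intro: divide_left_mono)
  have X_Suc: "X (Suc k) = X k - (1 / \<eta> k) *\<^sub>R ?d k" for k
    using X_plam by (simp add: plam_sequence_def grad_aug_lagrangian_eq_plam_dir[OF f_C2])
  have XC: "X k \<in> \<C>" for k
  proof (induction k)
    case (Suc k)
    then show ?case unfolding X_Suc using \<eta>k(1,2)[of k] by (intro step_in_C) auto
  qed (use X0C X_init in simp)

  \<comment> \<open>Decrease per iteration and summation\<close>
  have decrease_strict: "c3 * (norm (?d k))\<^sup>2 < ?\<Phi> (X k) - ?\<Phi> (X (Suc k))" if "?d k \<noteq> 0" for k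
  proof -
    let ?t = "1 / \<eta> k"
    have "?t * (L\<^sub>h * 1) \<le> \<tau> * (L\<^sub>h * 1)"
      using \<eta>k(1-3)[of k] L\<^sub>h_pos by (intro mult_right_mono) auto
    then have tL: "L\<^sub>h * ?t \<le> 2 * c1" using \<tau>L by (simp add: mult.commute)
    have "2 * ?t * \<beta> * (R + 2 * M\<^sup>2) \<le> 2 * \<tau> * \<beta> * (R + 2 * M\<^sup>2)"
      using \<eta>k(1-3)[of k] \<beta>0 RM by (intro mult_right_mono mult_left_mono) auto
    then have t\<beta>: "2 * ?t * \<beta> * (R + 2 * M\<^sup>2) \<le> 1" using \<tau>\<beta> by linarith
    have seg: "norm (infeas (X k - u *\<^sub>R ?d k)) \<le> R" if "0 \<le> u" "u \<le> ?t" for u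
      using step_in_C[OF XC[of k] that(1)] that(2) \<eta>k(2)[of k] unfolding C by linarith
    have "?\<Phi> (X (Suc k)) < ?\<Phi> (X k) - ?t * (c1 - 3/8 * (L\<^sub>h * ?t)) * (norm (?d k))\<^sup>2"
      unfolding X_Suc
      by (rule plam_potential_decrease[OF f_C2 M_ge[unfolded C] N_ge[OF XC] L_ge[OF XC] seg
            L\<^sub>h_Lipschitz[unfolded C] R(2) _ _ c1_range curv _ t\<beta> tL that])
        (use \<beta>0 \<beta>\<mu> \<eta>k(1)[of k] in auto)
    moreover have "c3 \<le> ?t * (c1 - 3/8 * (L\<^sub>h * ?t))"
      using decrease_constant_le[OF \<eta>k(4) \<eta>k(3) _ tL] L\<^sub>h_pos
      by (simp add: c3_def power_divide)
    ultimately show ?thesis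
      using mult_right_mono[of c3 "?t * (c1 - 3/8 * (L\<^sub>h * ?t))" "(norm (?d k))\<^sup>2"] by simp
  qed
  \<comment> \<open>If the direction vanishes the iterate does not move, and both sides are
    zero.\<close>
  have decrease: "c3 * (norm (?d k))\<^sup>2 \<le> ?\<Phi> (X k) - ?\<Phi> (X (Suc k))" for k
    using decrease_strict[of k] by (cases "?d k = 0") (auto simp: X_Suc)
  define B where "B = f X0 - f_low + M * N * R + \<beta> * R\<^sup>2 / 4"
  have telescope: "(\<Sum>k<K. ?\<Phi> (X k) - ?\<Phi> (X (Suc k))) \<le> B" for K
  proof -
    have "(\<Sum>k<K. ?\<Phi> (X k) - ?\<Phi> (X (Suc k))) = ?\<Phi> (X 0) - ?\<Phi> (X K)" by (induction K) auto
    also have "\<dots> \<le> f (X 0) - f_low + ?\<mu> * R + \<beta> * R\<^sup>2 / 4"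
      using c1_range \<beta>0 \<mu>0 XC by (intro plam_potential_diff_le mult_bound f_ge) (auto simp: C)
    finally show ?thesis by (simp add: B_def X_init)
  qed
  have sum_le: "(\<Sum>k<K. c3 * (norm (?d k))\<^sup>2) \<le> B" for K
    by (rule order_trans[OF sum_mono[OF decrease] telescope])
  have normal: "(\<beta>\<^sup>2 * ?s - 2 * \<beta> * ?\<mu>) * (norm (infeas Y))\<^sup>2 \<le> (norm (plam_dir f \<beta> Y))\<^sup>2"
    if Y: "Y \<in> \<C>" for Y
  proof -
    have "norm (infeas Y) \<le> 1 - ?s" using Y R(2) unfolding C by linarith
    from normal_component_bounds(1)[OF M_ge[OF Y] N_ge[OF Y] this, of \<beta>] show ?thesis
      by (rule order_trans) (use \<beta>0 \<beta>\<mu> in auto)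
  qed
  have normal_coeff: "0 < \<beta>\<^sup>2 * ?s - 2 * \<beta> * ?\<mu>"
  proof -
    have "0 < \<beta> * (\<beta> * ?s - 2 * ?\<mu>)" using \<beta>0 \<beta>\<mu> \<mu>0 by (intro mult_pos_pos) auto
    then show ?thesis by (simp add: power2_eq_square algebra_simps)
  qed
  have infeas_zero: "infeas Y = 0" if "Y \<in> \<C>" "plam_dir f \<beta> Y = 0" for Y
    using normal[OF that(1)] that(2) normal_coeff by (simp add: mult_le_0_iff)

  have "\<exists>l. cluster_point X l"
    using compact XC unfolding compact_def cluster_point_def by blast
  moreover have "first_order_stationary f l" if l: "cluster_point X l" for l
  proof -
    obtain r where r: "strict_mono r" "(X \<circ> r) \<longlonglongrightarrow> l"
      using l by (auto simp: cluster_point_def)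
    have lC: "l \<in> \<C>"
      by (rule closed_sequentially[OF compact_imp_closed[OF compact] _ r(2)]) (simp add: XC)
    have "?d \<longlonglongrightarrow> 0"
      by (rule tendsto_zero_of_sum_norm_sq_bounded[OF c3_pos sum_le])
    then have "(?d \<circ> r) \<longlonglongrightarrow> 0" using r(1) by (rule LIMSEQ_subseq_LIMSEQ)
    moreover have "(\<lambda>k. plam_dir f \<beta> ((X \<circ> r) k)) \<longlonglongrightarrow> plam_dir f \<beta> l"
      using continuous_on_plam_dir[OF f_C2, of UNIV \<beta>]
      by (intro isCont_tendsto_compose[OF _ r(2)]) (simp add: continuous_on_eq_continuous_at)
    ultimately have "plam_dir f \<beta> l = 0"
      by (auto simp: comp_def intro: LIMSEQ_unique)
    with infeas_zero[OF lC] show ?thesis by (intro first_order_stationaryI)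
  qed
  moreover have "Min ((\<lambda>k. norm (?d k)) ` {0..K - 1}) < sqrt (B / (c3 * real K))" if K: "K > 1" for K
  proof -
    let ?m = "Min ((\<lambda>k. norm (?d k)) ` {0..K - 1})"
    have m_le: "?m \<le> norm (?d k)" if "k < K" for k
      using that by (intro Min_le) auto
    have m0: "0 \<le> ?m" by (subst Min_ge_iff) auto
    \<comment> \<open>The initial guess is infeasible, so its direction is nonzero and the first
      decrease is strict. This one term makes the final rate strict.\<close>
    have "infeas (X 0) \<noteq> 0" using R by (auto simp: X_init R_def infeas_def)
    then have d0: "0 < norm (?d 0)" using infeas_zero[OF XC] by auto
    have "c3 * real K * ?m\<^sup>2 = (\<Sum>k<K. c3 * ?m\<^sup>2)" by simp
    also have "\<dots> \<le> (\<Sum>k<K. c3 * (norm (?d k))\<^sup>2)"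
      using c3_pos m0 m_le by (intro sum_mono mult_left_mono power_mono) auto
    also have "\<dots> < (\<Sum>k<K. ?\<Phi> (X k) - ?\<Phi> (X (Suc k)))"
      using K d0 decrease decrease_strict[of 0] by (intro sum_strict_mono_ex1) auto
    also note telescope
    finally have "c3 * real K * ?m\<^sup>2 < B" .
    then have "?m\<^sup>2 < B / (c3 * real K)"
      using c3_pos K by (simp add: pos_less_divide_eq mult.commute)
    then show ?thesis by (rule real_less_rsqrt)
  qed
  ultimately show ?thesis
    by (simp add: grad_aug_lagrangian_eq_plam_dir[OF f_C2] B_def)
qed

end
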